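(* Let $n\ge 2$, $m\ge1$. Assume that $\alpha_i>1$ and $l_i>0$ for every $i\in\{1,\dots,m\}$, and that $g:\mathbb{R}^n\to\mathbb{R}$ is locally Lipschitz continuous on $\mathbb{R}^n$. Then $V^g$ is locally Lipschitz continuous on $\Omega$, and for every $\mathbf{y}=(x_{P_1}^\top,\dots,x_{P_m}^\top,x_E^\top)^\top\in\Omega$, $$\partial V^g(\mathbf{y})\subseteq\mathrm{co}\,\hat{\mathcal{Q}}(\mathbf{y}),$$ where $\hat{\mathcal{Q}}(\mathbf{y})$ is the set of all $\mathbf{p}=(p_{P_1}^\top,\dots,p_{P_m}^\top,p_E^\top)^\top$ for which there exist $x\in\mathcal{P}(\mathbf{y})$ and $(\lambda_1,\dots,\lambda_m)\in\mathbb{R}^m$ such that $$\lambda_i\ge 0,\qquad \lambda_i\hat{d}_i(x;x_{P_i},x_E)=0\qquad(i=1,\dots,m),$$ $$0\in\partial g(x)+\sum_{i=1}^m\lambda_iD_x\hat{d}_i(x;x_{P_i},x_E),$$ and $$p_{P_i}=8\alpha_il_i\lambda_i\|x-x_E\|(x-x_{P_i})\quad(i=1,\dots,m),\qquad p_E=-\sum_{i=1}^m8\alpha_i^2l_i\lambda_i\|x-x_{P_i}\|(x-x_E).$$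
   Context: $\|\cdot\|$ is the Euclidean norm; $\mathrm{co}$ denotes convex hull. Points of $\mathbb{R}^{(m+1)n}$ are written $\mathbf{y}=(x_{P_1}^\top,\dots,x_{P_m}^\top,x_E^\top)^\top$ with blocks in $\mathbb{R}^n$, and similarly for $\mathbf{p}$. $\Omega=\{\mathbf{y}:\|x_{P_i}-x_E\|>l_i\ \text{for all } i\}$. For $\mathbf{y}\in\Omega$: $d_i(x;x_{P_i},x_E)=-\|x-x_{P_i}\|+\alpha_i\|x-x_E\|+l_i$, $\mathcal{D}_i(x_{P_i},x_E)=\{x\in\mathbb{R}^n:d_i(x;x_{P_i},x_E)\le 0\}$, $\mathcal{D}^*(\mathbf{y})=\bigcap_{i=1}^m\mathcal{D}_i(x_{P_i},x_E)$, $V^g(\mathbf{y})=\min_{x\in\mathcal{D}^*(\mathbf{y})}g(x)$, $\mathcal{P}(\mathbf{y})=\{x\in\mathcal{D}^*(\mathbf{y}):g(x)=V^g(\mathbf{y})\}$, and $$\hat{d}_i(x;x_{P_i},x_E)=-\big(\|x-x_{P_i}\|^2-\alpha_i^2\|x-x_E\|^2-l_i^2\big)^2+4\alpha_i^2l_i^2\|x-x_E\|^2.$$ For a function $f$ locally Lipschitz near $x$, $\partial f(x)$ is Clarke's generalized gradient: the convex hull of all limits $\lim_k Df(x_k)$ with $x_k\to x$ and $f$ differentiable at $x_k$. $D_x$ denotes the gradient with respect to $x$. *)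

theory Defs
  imports "HOL-Analysis.Analysis"
begin

definition locally_lipschitz_on ::
    "'a::metric_space set \<Rightarrow> ('a \<Rightarrow> 'b::metric_space) \<Rightarrow> bool" where
  "locally_lipschitz_on S f \<longleftrightarrow>
     (\<forall>x\<in>S. \<exists>e>0. \<exists>L. L-lipschitz_on (ball x e \<inter> S) f)"

text \<open>The gradient is meaningful only at points of differentiability, where it is unique.\<close>

definition gradient :: "('a::real_inner \<Rightarrow> real) \<Rightarrow> 'a \<Rightarrow> 'a" where
  "gradient f x = (THE D. GDERIV f x :> D)"

definition clarke_gradient :: "('a::real_inner \<Rightarrow> real) \<Rightarrow> 'a \<Rightarrow> 'a set" where
  "clarke_gradient f x = convex hull
     {v. \<exists>X. X \<longlonglongrightarrow> x \<and> (\<forall>k. f differentiable (at (X k))) \<and>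
         (\<lambda>k. gradient f (X k)) \<longlonglongrightarrow> v}"

text \<open>
  A configuration \<open>y = (x\<^sub>P\<^sub>1, \<dots>, x\<^sub>P\<^sub>m, x\<^sub>E)\<close> in the Euclidean space of dimension
  \<open>(m + 1) n\<close> is a pair: \<open>fst y $ i\<close> is the block \<open>x\<^sub>P\<^sub>i\<close> and \<open>snd y\<close> is the block \<open>x\<^sub>E\<close>.
  The norm and inner product of this type are the Euclidean ones on the concatenated vector,
  so gradients of functions of \<open>y\<close> are again tuples of blocks.
\<close>

type_synonym ('n, 'm) config = "((real^'n)^'m) \<times> (real^'n)"

definition Omega :: "('m::finite \<Rightarrow> real) \<Rightarrow> ('n::finite, 'm) config set" where
  "Omega l = {y. \<forall>i. norm (fst y $ i - snd y) > l i}"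

definition d_fun :: "real \<Rightarrow> real \<Rightarrow> real^'n::finite \<Rightarrow> real^'n \<Rightarrow> real^'n \<Rightarrow> real" where
  "d_fun a l x xP xE = - norm (x - xP) + a * norm (x - xE) + l"

definition d_hat :: "real \<Rightarrow> real \<Rightarrow> real^'n::finite \<Rightarrow> real^'n \<Rightarrow> real^'n \<Rightarrow> real" where
  "d_hat a l x xP xE =
     - ((norm (x - xP))\<^sup>2 - a\<^sup>2 * (norm (x - xE))\<^sup>2 - l\<^sup>2)\<^sup>2
     + 4 * a\<^sup>2 * l\<^sup>2 * (norm (x - xE))\<^sup>2"

definition Dom :: "real \<Rightarrow> real \<Rightarrow> real^'n::finite \<Rightarrow> real^'n \<Rightarrow> (real^'n) set" where
  "Dom a l xP xE = {x. d_fun a l x xP xE \<le> 0}"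

definition Dom_star ::
    "('m::finite \<Rightarrow> real) \<Rightarrow> ('m \<Rightarrow> real) \<Rightarrow> ('n::finite, 'm) config \<Rightarrow> (real^'n) set" where
  "Dom_star \<alpha> l y = (\<Inter>i. Dom (\<alpha> i) (l i) (fst y $ i) (snd y))"

text \<open>\<open>LEAST\<close> is a genuine minimum: it is specified only if the minimum is attained.\<close>

definition Vg ::
    "('m::finite \<Rightarrow> real) \<Rightarrow> ('m \<Rightarrow> real) \<Rightarrow> (real^'n::finite \<Rightarrow> real) \<Rightarrow> ('n, 'm) config \<Rightarrow> real" where
  "Vg \<alpha> l g y = (LEAST v. v \<in> g ` Dom_star \<alpha> l y)"

definition Pset ::
    "('m::finite \<Rightarrow> real) \<Rightarrow> ('m \<Rightarrow> real) \<Rightarrow> (real^'n::finite \<Rightarrow> real) \<Rightarrow> ('n, 'm) config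
      \<Rightarrow> (real^'n) set" where
  "Pset \<alpha> l g y = {x \<in> Dom_star \<alpha> l y. g x = Vg \<alpha> l g y}"

text \<open>The multipliers \<open>\<lambda>\<^sub>i\<close> are written \<open>\<mu> i\<close>, since \<open>\<lambda>\<close> is reserved.\<close>

definition Q_hat ::
    "('m::finite \<Rightarrow> real) \<Rightarrow> ('m \<Rightarrow> real) \<Rightarrow> (real^'n::finite \<Rightarrow> real) \<Rightarrow> ('n, 'm) config
      \<Rightarrow> ('n, 'm) config set" where
  "Q_hat \<alpha> l g y =
     {p. \<exists>x \<in> Pset \<alpha> l g y. \<exists>\<mu> :: 'm \<Rightarrow> real.
        (\<forall>i. \<mu> i \<ge> 0 \<and> \<mu> i * d_hat (\<alpha> i) (l i) x (fst y $ i) (snd y) = 0) \<and>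
        0 \<in> (\<lambda>\<xi>. \<xi> + (\<Sum>i\<in>UNIV. \<mu> i *\<^sub>R
               gradient (\<lambda>z. d_hat (\<alpha> i) (l i) z (fst y $ i) (snd y)) x)) ` clarke_gradient g x \<and>
        (\<forall>i. fst p $ i =
               (8 * \<alpha> i * l i * \<mu> i * norm (x - snd y)) *\<^sub>R (x - fst y $ i)) \<and>
        snd p = - (\<Sum>i\<in>UNIV.
               (8 * (\<alpha> i)\<^sup>2 * l i * \<mu> i * norm (x - fst y $ i)) *\<^sub>R (x - snd y))}"

end

theory Submission
  imports Defs
begin

text \<open>
  Let \<open>V\<close> be differentiable at \<open>Y\<^sub>k \<rightarrow> y\<close> with gradients converging to \<open>v\<close>, and let minimisers
  \<open>X\<^sub>k\<close> at \<open>Y\<^sub>k\<close> converge to a minimiser \<open>x\<close> at \<open>y\<close>. If \<open>(w, u)\<close> is a direction along which every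
  constraint active at \<open>(x, y)\<close> strictly decreases, then \<open>X\<^sub>k + t w\<close> is admissible at \<open>Y\<^sub>k + t u\<close>, so
  \<open>V (Y\<^sub>k + t u) - V (Y\<^sub>k) \<le> g (X\<^sub>k + t w) - g (X\<^sub>k)\<close>; hence \<open>u \<bullet> v\<close> is at most the maximum of
  \<open>w \<bullet> \<xi>\<close> over the Clarke gradient of \<open>g\<close> at \<open>x\<close>. Separation turns this into multipliers. The
  direction from \<open>x\<close> to the evader decreases all constraints because \<open>\<alpha>\<^sub>i > 1\<close>; it gives the Slater
  condition as well as the Lipschitz continuity of \<open>V\<close>.

  Bounding increments of \<open>g\<close> by limits of its gradients needs Rademacher's theorem. It is obtained
  from Lebesgue points: a common Lebesgue point of the directional slopes along the coordinate
  axes is a point of differentiability, because increments can be compared with their averages over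
  small balls, where Fubini's theorem controls the oscillation of the slopes.
\<close>

text \<open>The multipliers are found for \<open>d_fun\<close> and only then converted to
  \<open>d_hat\<close>. Where \<open>d_fun\<close> vanishes, with e and p the distances from x to
  the evader and to the pursuer, p = \<alpha> e + l, and the gradient of \<open>d_hat\<close> is 8
  \<alpha> l e p times that of \<open>d_fun\<close>; dividing the multipliers by this factor
  produces the constants in \<open>Q_hat\<close>. The kinks of \<open>d_fun\<close> at the two
  players do no harm: at an active constraint x is not the evader, because in \<open>Omega\<close>
  the players are more than l apart, and not the pursuer, because \<alpha> e + l > 0. The direction
  is known to decrease the constraints at the limit (x, y) only, but it is used at nearby pairs.
  Hence the constraints are estimated on a whole neighbourhood by exact inequalities for the norm
  instead of an expansion at one point. Likewise the bound for \<open>g\<close> has to hold on every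
  short segment near x, even one that consists of points of non-differentiability; such a segment is
  replaced by a parallel one nearby, which Fubini's theorem makes good almost everywhere.\<close>

subsection \<open>Lebesgue points\<close>

text \<open>A closed T inside F leaves F - T of measure below e * \<eta>. Small balls around points
  off F miss T, so what they contain of F lies in F - T; disjoint balls of F-density above e,
  selected by Vitali's theorem, therefore have total measure at most \<eta>.\<close>

lemma negligible_upper_density:
  fixes F :: "'a::euclidean_space set"
  assumes F: "F \<in> sets borel" and e: "e > 0"
  shows "negligible {x \<in> -F. \<forall>d>0. \<exists>r>0. r < d \<and> measure lborel (F \<inter> cball x r) > e * measure lborel (cball x r)}"
    (is "negligible ?A")
  unfolding negligible_outer_le
proof (intro allI impI)
  fix \<eta> :: real assume \<eta>: "\<eta> > 0"
  have "F \<in> sets lebesgue" using F by auto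
  then obtain T where T: "closed T" "T \<subseteq> F" "F - T \<in> lmeasurable" "emeasure lebesgue (F - T) < ennreal (e * \<eta>)"
    using sets_lebesgue_inner_closed[of F "e * \<eta>", OF _ mult_pos_pos[OF e \<eta>]] by blast
  have mT: "measure lebesgue (F - T) \<le> e * \<eta>"
    using T(3,4) e \<eta> by (simp add: emeasure_eq_measure2 ennreal_less_iff)
  define K where "K = {(x, r). 0 < r \<and> cball x r \<inter> T = {} \<and> measure lborel (F \<inter> cball x r) > e * measure lborel (cball x r)}"
  have cov: "\<exists>i. i \<in> K \<and> x \<in> cball (fst i) (snd i) \<and> snd i < d" if x: "x \<in> ?A" and d: "0 < d" for x d
  proof -
    have "x \<in> - T" "open (- T)" using x T by auto
    then obtain d' where d': "d' > 0" "ball x d' \<subseteq> - T" by (meson openE)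
    have "\<forall>d>0. \<exists>r>0. r < d \<and> measure lborel (F \<inter> cball x r) > e * measure lborel (cball x r)"
      using x by simp
    moreover have "min d d' > 0" using d d' by simp
    ultimately obtain r where r: "0 < r" "r < min d d'" "measure lborel (F \<inter> cball x r) > e * measure lborel (cball x r)"
      by blast
    have "cball x r \<subseteq> ball x d'" using r by (simp add: cball_subset_ball_iff)
    then have "(x, r) \<in> K" using r d' by (auto simp: K_def)
    with r show ?thesis by (intro exI[of _ "(x, r)"]) auto
  qed
  have pos: "0 < snd i" if "i \<in> K" for i using that by (auto simp: K_def)
  obtain C where C: "countable C" "C \<subseteq> K"
     "pairwise (\<lambda>i j. disjnt (cball (fst i) (snd i)) (cball (fst j) (snd j))) C"
     "negligible (?A - (\<Union>i \<in> C. cball (fst i) (snd i)))"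
    by (rule Vitali_covering_theorem_cballs[of K snd ?A fst, OF pos cov]) (assumption, assumption, assumption, rule that)
  let ?U = "\<Union>i\<in>C. cball (fst i) (snd i)"
  have le: "measure lebesgue (\<Union>i\<in>D. cball (fst i) (snd i)) \<le> \<eta>" if D: "D \<subseteq> C" "finite D" for D
  proof -
    have pw: "pairwise (\<lambda>i j. disjnt (cball (fst i) (snd i)) (cball (fst j) (snd j))) D"
      using C(3) D by (meson pairwise_subset)
    have eq: "measure lborel (F \<inter> cball (fst i) (snd i)) = measure lebesgue ((F - T) \<inter> cball (fst i) (snd i))" if "i \<in> D" for i
    proof -
      have "i \<in> K" using that D C(2) by blast
      then have "cball (fst i) (snd i) \<inter> T = {}" by (simp add: K_def case_prod_unfold)
      then have "F \<inter> cball (fst i) (snd i) = (F - T) \<inter> cball (fst i) (snd i)" by blast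
      then show ?thesis using F by (metis borel_closed closed_cball measure_completion sets.Int sets_lborel)
    qed
    have m: "(F - T) \<inter> cball (fst i) (snd i) \<in> lmeasurable" for i :: "'a \<times> real"
      using T(3) by (simp add: fmeasurable.Int)
    have "e * measure lebesgue (\<Union>i\<in>D. cball (fst i) (snd i)) = (\<Sum>i\<in>D. e * measure lborel (cball (fst i) (snd i)))"
      using D pw by (subst measure_UNION') (auto simp: sum_distrib_left)
    also have "\<dots> \<le> (\<Sum>i\<in>D. measure lborel (F \<inter> cball (fst i) (snd i)))"
      using D C(2) by (intro sum_mono) (auto simp: K_def)
    also have "\<dots> = (\<Sum>i\<in>D. measure lebesgue ((F - T) \<inter> cball (fst i) (snd i)))"
      using eq by simp
    also have "\<dots> = measure lebesgue (\<Union>i\<in>D. (F - T) \<inter> cball (fst i) (snd i))"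
    proof (rule measure_UNION'[symmetric])
      show "pairwise (\<lambda>i j. disjnt ((F - T) \<inter> cball (fst i) (snd i)) ((F - T) \<inter> cball (fst j) (snd j))) D"
        using pw by (rule pairwise_mono) (auto simp: disjnt_def)
    qed (use D m in auto)
    also have "\<dots> \<le> measure lebesgue (F - T)"
    proof (rule measure_mono_fmeasurable)
      show "(\<Union>i\<in>D. (F - T) \<inter> cball (fst i) (snd i)) \<in> sets lebesgue"
        using D m by (intro sets.finite_UN fmeasurableD) auto
    qed (use T in auto)
    also have "\<dots> \<le> e * \<eta>" by (rule mT)
    finally show ?thesis using e by simp
  qed
  have U: "?U \<in> lmeasurable" "measure lebesgue ?U \<le> \<eta>"
    by (rule fmeasurable_UN_bound[of C] measure_UN_bound[of C]; use C le in auto)+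
  have N: "?A - ?U \<in> lmeasurable" "measure lebesgue (?A - ?U) = 0"
    using C(4) by (simp_all add: negligible_imp_measurable negligible_imp_measure0)
  show "\<exists>T. ?A \<subseteq> T \<and> T \<in> lmeasurable \<and> measure lebesgue T \<le> \<eta>"
  proof (intro exI conjI)
    show "measure lebesgue (?U \<union> (?A - ?U)) \<le> \<eta>"
      using U N measure_Un_le[of ?U lebesgue "?A - ?U"] by (simp add: fmeasurableD)
    show "?U \<union> (?A - ?U) \<in> lmeasurable" using U N by (intro fmeasurable.Un)
  qed auto
qed

text \<open>Rational thresholds reduce the claim to countably many level sets. For q1 < h x < q2
  close to \<open>h x\<close>, the point x lies outside {h < q1} and {h > q2}, so for almost every x
  both sets have small density at x. On them the integrand is at most 2 * M, elsewhere at most e /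
  4.\<close>

lemma lebesgue_points:
  fixes h :: "'a::euclidean_space \<Rightarrow> real"
  assumes h[measurable]: "h \<in> borel_measurable borel" and M: "\<And>x. \<bar>h x\<bar> \<le> M"
  shows "AE x in lborel. \<forall>e>0. \<exists>d>0. \<forall>r. 0 < r \<and> r < d \<longrightarrow>
           (\<integral>y\<in>cball x r. \<bar>h y - h x\<bar> \<partial>lborel) \<le> e * measure lborel (cball x r)"
proof -
  have M0: "0 \<le> M" using M[of undefined] by linarith
  define B where "B F e = {x \<in> -F. \<forall>d>0. \<exists>r>0. r < d \<and> measure lborel (F \<inter> cball x r) > e * measure lborel (cball x r)}"
    for F :: "'a set" and e :: real
  define N where "N = (\<Union>(q::rat, k::nat) \<in> UNIV. B {x. h x > of_rat q} (1 / Suc k) \<union> B {x. h x < of_rat q} (1 / Suc k))"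
  have "negligible (B F (1 / Suc k))" if "F \<in> sets borel" for F :: "'a set" and k
    unfolding B_def using that by (rule negligible_upper_density) auto
  then have "negligible N"
    unfolding N_def case_prod_unfold
    by (intro negligible_countable_Union) (auto intro!: negligible_Un)
  then have "N \<in> null_sets lebesgue" by (simp add: negligible_iff_null_sets)
  then have "AE x in lebesgue. x \<notin> N" by (rule AE_not_in)
  then have "AE x in lborel. x \<notin> N" by (simp add: AE_completion_iff)
  then show ?thesis
  proof (eventually_elim, intro allI impI)
    fix x e assume x: "x \<notin> N" and e: "(e::real) > 0"
    \<comment> \<open>The two exceptional sets together contribute at most 4 * M / Suc k times the
      volume of the ball; this choice keeps the factor within e / 2.\<close>
    obtain k :: nat where k: "1 / Suc k < e / (8 * (M + 1))"
      using e M0 by (metis divide_pos_pos nat_approx_posE zero_less_numeral mult_pos_pos add_nonneg_pos zero_less_one)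
    obtain q1 q2 :: rat where q: "h x - e/4 < of_rat q1" "of_rat q1 < h x" "h x < of_rat q2" "of_rat q2 < h x + e/4"
      using of_rat_dense[of "h x - e/4" "h x"] of_rat_dense[of "h x" "h x + e/4"] e by auto
    define F where "F = {y. h y > of_rat q2}"
    define G where "G = {y. h y < of_rat q1}"
    have [measurable]: "F \<in> sets borel" "G \<in> sets borel" by (auto simp: F_def G_def)
    have *: "\<exists>d>0. \<forall>r. 0 < r \<and> r < d \<longrightarrow> measure lborel (S \<inter> cball x r) \<le> e * measure lborel (cball x r)"
      if "x \<notin> B S e" "x \<in> - S" for S e
      using that unfolding B_def mem_Collect_eq not_less[symmetric] by blast
    have "x \<notin> B F (1 / Suc k)" "x \<notin> B G (1 / Suc k)" "x \<in> -F" "x \<in> -G"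
      using x q by (auto simp: N_def F_def G_def)
    then obtain d1 d2 where d1: "d1 > 0" "\<And>r. 0 < r \<Longrightarrow> r < d1 \<Longrightarrow> measure lborel (F \<inter> cball x r) \<le> (1 / Suc k) * measure lborel (cball x r)"
      and d2: "d2 > 0" "\<And>r. 0 < r \<Longrightarrow> r < d2 \<Longrightarrow> measure lborel (G \<inter> cball x r) \<le> (1 / Suc k) * measure lborel (cball x r)"
      using *[of F "1 / Suc k"] *[of G "1 / Suc k"] by blast
    show "\<exists>d>0. \<forall>r. 0 < r \<and> r < d \<longrightarrow> (\<integral>y\<in>cball x r. \<bar>h y - h x\<bar> \<partial>lborel) \<le> e * measure lborel (cball x r)"
    proof (intro exI[of _ "min d1 d2"] conjI allI impI)
      fix r assume r: "0 < r \<and> r < min d1 d2"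
      let ?c = "measure lborel (cball x r)"
      have fin: "emeasure lborel (S \<inter> cball x r) < \<infinity>" for S
        using emeasure_mono[of "S \<inter> cball x r" "cball x r" lborel] emeasure_lborel_cball_finite[of x r]
        by (auto simp: le_less_trans)
      have [simp]: "integrable lborel (indicat_real (S \<inter> cball x r))" if "S \<in> sets borel" for S
        using that fin by (intro integrable_real_indicator) auto
      have [simp]: "integrable lborel (indicat_real (cball x r))"
        using emeasure_lborel_cball_finite[of x r] by (intro integrable_real_indicator) auto
      have "(\<integral>y\<in>cball x r. \<bar>h y - h x\<bar> \<partial>lborel) \<le>
            (\<integral>y. e/4 * indicat_real (cball x r) y + 2 * M * indicat_real (F \<inter> cball x r) y + 2 * M * indicat_real (G \<inter> cball x r) y \<partial>lborel)"
        unfolding set_lebesgue_integral_def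
      proof (rule integral_mono_AE')
        show "AE y in lborel. indicat_real (cball x r) y *\<^sub>R \<bar>h y - h x\<bar>
          \<le> e/4 * indicat_real (cball x r) y + 2 * M * indicat_real (F \<inter> cball x r) y + 2 * M * indicat_real (G \<inter> cball x r) y"
        proof (intro AE_I2)
          fix y
          have "\<bar>h y - h x\<bar> \<le> 2 * M" using M[of x] M[of y] by linarith
          moreover have "\<bar>h y - h x\<bar> \<le> e / 4" if "y \<notin> F" "y \<notin> G" using that q unfolding F_def G_def mem_Collect_eq by linarith
          ultimately show "indicat_real (cball x r) y *\<^sub>R \<bar>h y - h x\<bar>
            \<le> e/4 * indicat_real (cball x r) y + 2 * M * indicat_real (F \<inter> cball x r) y + 2 * M * indicat_real (G \<inter> cball x r) y"
            using e M0 by (auto simp: indicator_def)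
        qed
      qed (use e M0 in \<open>auto intro!: AE_I2 add_nonneg_nonneg\<close>)
      also have "\<dots> = e/4 * ?c + 2 * M * measure lborel (F \<inter> cball x r) + 2 * M * measure lborel (G \<inter> cball x r)"
        by simp
      also have "\<dots> \<le> e/4 * ?c + 2 * M * ((1 / Suc k) * ?c) + 2 * M * ((1 / Suc k) * ?c)"
        using d1 d2 r M0 e by (intro add_mono mult_left_mono) auto
      also have "\<dots> = (e/4 + 4 * M * (1 / Suc k)) * ?c" by (simp add: algebra_simps)
      also have "\<dots> \<le> (e/4 + 4 * M * (e / (8 * (M + 1)))) * ?c"
        using k M0 by (intro mult_right_mono add_left_mono mult_left_mono) auto
      also have "\<dots> \<le> e * ?c"
        using e M0 by (intro mult_right_mono) (auto simp: field_simps add_pos_nonneg)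
      finally show "(\<integral>y\<in>cball x r. \<bar>h y - h x\<bar> \<partial>lborel) \<le> e * ?c" .
    qed (use d1 d2 in auto)
  qed
qed

subsection \<open>Rademacher's theorem\<close>

text \<open>\<open>L * x + f x\<close> and \<open>L * x - f x\<close> are both monotone, and their
  Stieltjes measures add up to 2 * L times Lebesgue measure. Each is thus absolutely continuous with
  density at most 2 * L, and subtracting L from the first density gives one for f.\<close>

lemma lipschitz_real_density:
  fixes f :: "real \<Rightarrow> real"
  assumes L: "L-lipschitz_on UNIV f"
  obtains q where "q \<in> borel_measurable borel" "\<And>x. \<bar>q x\<bar> \<le> L"
    "\<And>a b. a \<le> b \<Longrightarrow> f b - f a = (\<integral>x\<in>{a<..b}. q x \<partial>lborel)"
proof -
  have L0: "L \<ge> 0" using L by (rule lipschitz_on_nonneg)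
  have Lf: "\<bar>f y - f x\<bar> \<le> L * (y - x)" if "x \<le> y" for x y
    using lipschitz_onD[OF L, of y x] that by (simp add: dist_real_def)
  define F1 F2 where "F1 x = L * x + f x" and "F2 x = L * x - f x" for x
  have cf: "continuous_on UNIV f" using L by (rule lipschitz_on_continuous_on)
  have mono: "F1 x \<le> F1 y" "F2 x \<le> F2 y" if "x \<le> y" for x y
    using Lf[OF that] by (auto simp: F1_def F2_def algebra_simps)
  have cF: "continuous_on UNIV F1" "continuous_on UNIV F2"
    unfolding F1_def F2_def by (intro continuous_intros cf)+
  have rc: "continuous (at_right a) F1" "continuous (at_right a) F2" for a
    using cF by (auto simp: continuous_on_eq_continuous_at intro: continuous_at_imp_continuous_at_within)
  define N1 N2 where "N1 = interval_measure F1" and "N2 = interval_measure F2"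
  have N_Ioc: "emeasure N1 {a<..b} = ennreal (F1 b - F1 a)" "emeasure N2 {a<..b} = ennreal (F2 b - F2 a)"
    if "a \<le> b" for a b
    unfolding N1_def N2_def using that mono rc by (auto intro!: emeasure_interval_measure_Ioc)
  have sets_N[simp, measurable_cong]: "sets N1 = sets borel" "sets N2 = sets borel"
    by (auto simp: N1_def N2_def)
  \<comment> \<open>The sum of the two measures, packaged as a measure so that it can be compared
    with 2 * L times \<open>lborel\<close> on half-open intervals, an intersection-stable
    generator.\<close>
  define K where "K = measure_of UNIV (sets borel) (\<lambda>A. emeasure N1 A + emeasure N2 A)"
  have sets_K[simp]: "sets K = sets borel"
    unfolding K_def by (simp add: sigma_algebra.sigma_sets_eq[OF sets.sigma_algebra_axioms[of borel, simplified]])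
  have K: "emeasure K A = emeasure N1 A + emeasure N2 A" if "A \<in> sets borel" for A
  proof (rule emeasure_measure_of[OF K_def])
    show "countably_additive (sets K) (\<lambda>A. emeasure N1 A + emeasure N2 A)"
      unfolding sets_K
    proof (rule countably_additiveI)
      fix A :: "nat \<Rightarrow> real set" assume A: "range A \<subseteq> sets borel" "disjoint_family A"
      show "(\<Sum>i. emeasure N1 (A i) + emeasure N2 (A i)) = emeasure N1 (\<Union>(range A)) + emeasure N2 (\<Union>(range A))"
        using suminf_emeasure[of A N1] suminf_emeasure[of A N2] A
        by (subst suminf_add[symmetric]) auto
    qed
  qed (use that in \<open>auto simp: positive_def\<close>)
  have "K = density lborel (\<lambda>_. ennreal (2 * L))"
  proof (rule measure_eqI_generator_eq)
    let ?E = "range (\<lambda>(a, b). {a<..b::real})"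
    show "Int_stable ?E"
      by (auto simp: Int_stable_def intro!: exI[of _ "(max _ _, min _ _)"])
    show "?E \<subseteq> Pow UNIV" by auto
    show "sets K = sigma_sets UNIV ?E" "sets (density lborel (\<lambda>_. ennreal (2 * L))) = sigma_sets UNIV ?E"
      by (simp_all add: borel_sigma_sets_Ioc)
    show "emeasure K X = emeasure (density lborel (\<lambda>_. ennreal (2 * L))) X" if X_in: "X \<in> ?E" for X
    proof -
      obtain a b where X: "X = {a<..b}" using X_in by auto
      show ?thesis
      proof (cases "a \<le> b")
        case True
        have "emeasure K X = ennreal (F1 b - F1 a) + ennreal (F2 b - F2 a)"
          using True by (simp add: X K N_Ioc)
        also have "\<dots> = ennreal (2 * L * (b - a))"
          using mono[OF True] by (subst ennreal_plus[symmetric]) (auto simp: F1_def F2_def algebra_simps)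
        finally show ?thesis
          using True L0 by (simp add: X emeasure_density_const ennreal_mult)
      qed (simp add: X)
    qed
    show "range (\<lambda>n::nat. {- real n<..real n}) \<subseteq> ?E" by auto
    show "(\<Union>n::nat. {- real n<..real n}) = UNIV"
    proof -
      have "\<exists>n::nat. - real n < x \<and> x \<le> real n" for x
        using reals_Archimedean2[of "\<bar>x\<bar>"] by (auto simp: abs_less_iff) (metis less_le minus_less_iff)
      then show ?thesis by auto
    qed
    show "emeasure K {- real n<..real n} \<noteq> \<infinity>" for n :: nat
      by (simp add: K N_Ioc)
  qed
  then have le: "emeasure N1 A + emeasure N2 A = ennreal (2 * L) * emeasure lborel A" if "A \<in> sets borel" for A
    using K[OF that] that by (simp add: emeasure_density_const)
  then have zero: "emeasure N1 A = 0 \<and> emeasure N2 A = 0" if "A \<in> sets borel" "emeasure lborel A = 0" for A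
    using le[OF that(1)] that(2) by simp
  have ac: "absolutely_continuous lborel N1" "absolutely_continuous lborel N2"
    unfolding absolutely_continuous_def using zero by (auto simp: null_sets_def)
  obtain p1 p2 where p[measurable]: "p1 \<in> borel_measurable lborel" "p2 \<in> borel_measurable lborel"
      and pN: "density lborel p1 = N1" "density lborel p2 = N2"
    using sigma_finite_measure.Radon_Nikodym[OF sigma_finite_lborel ac(1)] sigma_finite_measure.Radon_Nikodym[OF sigma_finite_lborel ac(2)] by auto
  have "density lborel (\<lambda>x. p1 x + p2 x) = density lborel (\<lambda>_. ennreal (2 * L))"
  proof (rule measure_eqI)
    fix A assume "A \<in> sets (density lborel (\<lambda>x. p1 x + p2 x))"
    then have A[measurable]: "A \<in> sets borel" by simp
    have "emeasure (density lborel (\<lambda>x. p1 x + p2 x)) A = emeasure N1 A + emeasure N2 A"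
      unfolding pN[symmetric]
      by (subst (1 2 3) emeasure_density) (auto simp: distrib_right nn_integral_add)
    then show "emeasure (density lborel (\<lambda>x. p1 x + p2 x)) A = emeasure (density lborel (\<lambda>_. ennreal (2 * L))) A"
      by (simp add: le emeasure_density_const)
  qed simp
  then have "AE x in lborel. p1 x + p2 x = ennreal (2 * L)"
    by (subst (asm) sigma_finite_measure.density_unique_iff[OF sigma_finite_lborel]) auto
  then have p_le: "AE x in lborel. p1 x \<le> ennreal (2 * L)"
    by eventually_elim (metis le_iff_add)
  \<comment> \<open>The bound on \<open>p1\<close> holds only almost everywhere; truncation makes it
    hold at every point and changes values on a null set only.\<close>
  define p where "p x = min (2 * L) (enn2real (p1 x))" for x
  have p_meas[measurable]: "p \<in> borel_measurable borel" unfolding p_def by simp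
  have p_bd: "0 \<le> p x" "p x \<le> 2 * L" for x using L0 by (auto simp: p_def)
  have "AE x in lborel. p1 x = ennreal (p x)"
    using p_le
  proof eventually_elim
    fix x assume "p1 x \<le> ennreal (2 * L)"
    then have "enn2real (p1 x) \<le> 2 * L" "p1 x < top" using L0
      by (auto simp: enn2real_leI le_less_trans[OF _ ennreal_less_top])
    then show "p1 x = ennreal (p x)" by (simp add: p_def min_def)
  qed
  then have N1p: "density lborel (\<lambda>x. ennreal (p x)) = N1"
    unfolding pN(1)[symmetric] by (intro density_cong) auto
  define q where "q x = p x - L" for x
  show thesis
  proof (rule that)
    show "q \<in> borel_measurable borel" unfolding q_def by simp
    show "\<bar>q x\<bar> \<le> L" for x using p_bd[of x] by (auto simp: q_def)
    fix a b :: real assume ab: "a \<le> b"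
    have int[simp]: "integrable lborel (indicat_real {a<..b})"
      using ab by (intro integrable_real_indicator) auto
    have intp: "integrable lborel (\<lambda>x. indicat_real {a<..b} x * p x)"
      by (rule integrableI_bounded_set[where A="{a<..b}" and B="2 * L"]) (use ab p_bd in \<open>auto simp: indicator_def\<close>)
    have "ennreal (F1 b - F1 a) = emeasure (density lborel (\<lambda>x. ennreal (p x))) {a<..b}"
      using N_Ioc(1)[OF ab] N1p by simp
    also have "\<dots> = (\<integral>\<^sup>+x. ennreal (indicat_real {a<..b} x * p x) \<partial>lborel)"
      by (subst emeasure_density) (auto intro!: nn_integral_cong simp: indicator_def)
    also have "\<dots> = ennreal (\<integral>x. indicat_real {a<..b} x * p x \<partial>lborel)"
      by (rule nn_integral_eq_integral[OF intp]) (use p_bd in auto)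
    finally have "F1 b - F1 a = (\<integral>x. indicat_real {a<..b} x * p x \<partial>lborel)"
      using mono[OF ab] p_bd by (subst (asm) ennreal_inj) (auto intro!: integral_nonneg_AE)
    moreover have "(\<integral>x\<in>{a<..b}. q x \<partial>lborel) = (\<integral>x. indicat_real {a<..b} x * p x \<partial>lborel) - L * (b - a)"
      unfolding set_lebesgue_integral_def q_def using ab intp
      by (simp add: right_diff_distrib) (simp add: algebra_simps)
    ultimately show "f b - f a = (\<integral>x\<in>{a<..b}. q x \<partial>lborel)"
      by (simp add: F1_def algebra_simps)
  qed
qed

text \<open>Clamping to \<open>[-L, L]\<close> keeps the junk value of \<open>lim\<close> at points without a limit bounded.\<close>

definition right_slope :: "real \<Rightarrow> ('a::real_normed_vector \<Rightarrow> real) \<Rightarrow> 'a \<Rightarrow> 'a \<Rightarrow> real" where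
  "right_slope L f v x = max (- L) (min L (lim (\<lambda>k. (f (x + (1 / Suc k) *\<^sub>R v) - f x) * real (Suc k))))"

lemma abs_right_slope: "L \<ge> 0 \<Longrightarrow> \<bar>right_slope L f v x\<bar> \<le> L"
  by (auto simp: right_slope_def)

text \<open>The density from Radon-Nikodym is merely some function attached to f. The slope is an
  explicit limit, so for a function on a Euclidean space the slopes on all parallel lines are
  restrictions of one Borel function. The two agree at Lebesgue points of the density.\<close>

lemma lipschitz_real_integral_slope:
  fixes f :: "real \<Rightarrow> real"
  assumes L: "L-lipschitz_on UNIV f" and ab: "a \<le> b"
  shows "f b - f a = (\<integral>x\<in>{a<..b}. right_slope L f 1 x \<partial>lborel)"
proof -
  obtain q where q[measurable]: "q \<in> borel_measurable borel" and qL: "\<And>x. \<bar>q x\<bar> \<le> L"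
    and fq: "\<And>a b. a \<le> b \<Longrightarrow> f b - f a = (\<integral>x\<in>{a<..b}. q x \<partial>lborel)"
    using lipschitz_real_density[OF L] by metis
  have [measurable]: "f \<in> borel_measurable borel"
    using L by (intro borel_measurable_continuous_onI lipschitz_on_continuous_on)
  have [measurable]: "right_slope L f 1 \<in> borel_measurable borel"
    unfolding right_slope_def[abs_def] by measurable
  have "AE x in lborel. q x = right_slope L f 1 x"
    using lebesgue_points[OF q qL]
  proof eventually_elim
    case (elim x)
    have "(\<lambda>k. (f (x + (1 / Suc k) *\<^sub>R 1) - f x) * Suc k) \<longlonglongrightarrow> q x"
    proof (rule LIMSEQ_I)
      fix e :: real assume e: "e > 0"
      \<comment> \<open>The interval \<open>cball x t\<close> has length 2 * t, so e / 4 gives an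
        error of e / 2 * t, strictly below e * t.\<close>
      then obtain d where d: "d > 0" "\<And>r. 0 < r \<and> r < d \<Longrightarrow> (\<integral>y\<in>cball x r. \<bar>q y - q x\<bar> \<partial>lborel) \<le> (e/4) * measure lborel (cball x r)"
        using elim[rule_format, of "e/4"] by auto
      obtain k0 :: nat where k0: "1 / Suc k0 < d" using d(1) by (rule nat_approx_posE)
      show "\<exists>n0. \<forall>n\<ge>n0. norm ((f (x + (1 / Suc n) *\<^sub>R 1) - f x) * Suc n - q x) < e"
      proof (intro exI[of _ k0] allI impI)
        fix k assume k: "k \<ge> k0"
        define t where "t = 1 / real (Suc k)"
        have "1 / real (Suc k) \<le> 1 / real (Suc k0)" using k by (simp add: field_simps)
        then have t: "0 < t" "t < d" using k0 by (auto simp: t_def)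
        have [simp]: "integrable lborel (\<lambda>y. indicat_real {x<..x+t} y * q y)"
          by (rule integrableI_bounded_set[where A="{x<..x+t}" and B=L]) (use t qL in \<open>auto simp: indicator_def\<close>)
        have [simp]: "integrable lborel (indicat_real {x<..x+t})"
          using t by (intro integrable_real_indicator) auto
        have "f (x + t) - f x - t * q x = (\<integral>y. indicat_real {x<..x+t} y * (q y - q x) \<partial>lborel)"
          using t by (simp add: fq set_lebesgue_integral_def right_diff_distrib)
        also have "\<bar>\<dots>\<bar> \<le> (\<integral>y. indicat_real (cball x t) y * \<bar>q y - q x\<bar> \<partial>lborel)"
        proof (rule order_trans[OF integral_abs_bound])
          show "(\<integral>y. \<bar>indicat_real {x<..x+t} y * (q y - q x)\<bar> \<partial>lborel) \<le> (\<integral>y. indicat_real (cball x t) y * \<bar>q y - q x\<bar> \<partial>lborel)"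
          proof (rule integral_mono)
            show "integrable lborel (\<lambda>y. indicat_real (cball x t) y * \<bar>q y - q x\<bar>)"
            proof (rule integrableI_bounded_set[where A="cball x t" and B="2 * L"])
              show "AE y in lborel. y \<in> cball x t \<longrightarrow> norm (indicat_real (cball x t) y * \<bar>q y - q x\<bar>) \<le> 2 * L"
                using qL[of x] by (intro AE_I2) (use qL in \<open>auto simp: indicator_def intro: order_trans[OF abs_triangle_ineq4]\<close>, smt (verit) qL)
              show "emeasure lborel (cball x t) < \<infinity>" by (rule emeasure_lborel_cball_finite)
              show "(\<lambda>y. indicat_real (cball x t) y * \<bar>q y - q x\<bar>) \<in> borel_measurable lborel"
                by (intro borel_measurable_times borel_measurable_indicator borel_measurable_abs borel_measurable_diff) auto
            qed auto
            show "integrable lborel (\<lambda>y. \<bar>indicat_real {x<..x+t} y * (q y - q x)\<bar>)"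
              by (simp add: right_diff_distrib)
          qed (auto simp: indicator_def dist_real_def)
        qed
        also have "\<dots> \<le> (e/4) * measure lborel (cball x t)"
          using d(2)[of t] t by (simp add: set_lebesgue_integral_def)
        also have "\<dots> = e / 2 * t" using t by (simp add: cball_eq_atLeastAtMost)
        also have "\<dots> < e * t" using e t by simp
        finally have "\<bar>f (x + t) - f x - t * q x\<bar> < e * t" .
        then have "\<bar>(f (x + t) - f x) / t - q x\<bar> < e"
          using t by (simp add: field_simps abs_if split: if_splits)
        then show "norm ((f (x + (1 / Suc k) *\<^sub>R 1) - f x) * Suc k - q x) < e"
          by (simp add: t_def)
      qed
    qed
    then have "lim (\<lambda>k. (f (x + (1 / Suc k) *\<^sub>R 1) - f x) * Suc k) = q x" by (rule limI)
    then show ?case using qL[of x] by (auto simp: right_slope_def)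
  qed
  then have "(\<integral>x\<in>{a<..b}. q x \<partial>lborel) = (\<integral>x\<in>{a<..b}. right_slope L f 1 x \<partial>lborel)"
    unfolding set_lebesgue_integral_def
    by (intro integral_cong_AE) auto
  then show ?thesis using fq[OF ab] by simp
qed

lemma borel_measurable_right_slope:
  assumes "L-lipschitz_on UNIV (g :: 'a::euclidean_space \<Rightarrow> real)"
  shows "right_slope L g v \<in> borel_measurable borel"
proof -
  have [measurable]: "g \<in> borel_measurable borel"
    using assms by (intro borel_measurable_continuous_onI lipschitz_on_continuous_on)
  show ?thesis unfolding right_slope_def[abs_def] by measurable
qed

lemma lipschitz_integral_slope:
  fixes g :: "'a::euclidean_space \<Rightarrow> real"
  assumes L: "L-lipschitz_on UNIV g" and v: "norm v \<le> 1" and ab: "a \<le> b"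
  shows "g (x + b *\<^sub>R v) - g (x + a *\<^sub>R v) = (\<integral>s\<in>{a<..b}. right_slope L g v (x + s *\<^sub>R v) \<partial>lborel)"
proof -
  define f where "f s = g (x + s *\<^sub>R v)" for s
  have L0: "L \<ge> 0" using L by (rule lipschitz_on_nonneg)
  have "L-lipschitz_on UNIV f"
  proof (rule lipschitz_onI)
    fix s t :: real
    have "dist (f s) (f t) \<le> L * dist (x + s *\<^sub>R v) (x + t *\<^sub>R v)"
      unfolding f_def using L by (rule lipschitz_onD) auto
    also have "dist (x + s *\<^sub>R v) (x + t *\<^sub>R v) = \<bar>s - t\<bar> * norm v"
      by (simp add: dist_norm flip: scaleR_diff_left)
    also have "L * (\<bar>s - t\<bar> * norm v) \<le> L * (\<bar>s - t\<bar> * 1)"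
      using v L0 by (intro mult_left_mono) auto
    finally show "dist (f s) (f t) \<le> L * dist s t" by (simp add: dist_real_def)
  qed (rule L0)
  from lipschitz_real_integral_slope[OF this ab]
  have "f b - f a = (\<integral>s\<in>{a<..b}. right_slope L f 1 s \<partial>lborel)" .
  moreover have "right_slope L f 1 s = right_slope L g v (x + s *\<^sub>R v)" for s
    by (simp add: right_slope_def f_def algebra_simps)
  ultimately show ?thesis by (simp add: f_def)
qed

section \<open>Increments averaged over small balls\<close>

lemma nn_integral_lborel_translate:
  fixes f :: "'a::euclidean_space \<Rightarrow> ennreal"
  assumes "f \<in> borel_measurable borel"
  shows "(\<integral>\<^sup>+x. f (c + x) \<partial>lborel) = (\<integral>\<^sup>+x. f x \<partial>lborel)"
  using assms by (subst (2) lborel_distr_plus[of c, symmetric]) (simp add: nn_integral_distr)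

text \<open>Fubini's theorem swaps the integrals. For fixed \<tau> the shifted small ball lies in
  \<open>cball x R\<close>, so translation invariance bounds the inner integral; integration over
  \<tau> contributes the factor t.\<close>

lemma nn_integral_ball_segment_le:
  fixes k :: "'a::euclidean_space \<Rightarrow> ennreal"
  assumes k[measurable]: "k \<in> borel_measurable borel"
    and v: "norm v \<le> 1" and t: "t \<ge> 0" and R: "norm z + t + \<rho> \<le> R"
  shows "(\<integral>\<^sup>+s\<in>cball 0 \<rho>. (\<integral>\<^sup>+\<tau>\<in>{0<..t}. k (x + z + s + \<tau> *\<^sub>R v) \<partial>lborel) \<partial>lborel)
           \<le> ennreal t * (\<integral>\<^sup>+u\<in>cball x R. k u \<partial>lborel)"
proof -
  have [measurable]: "cball 0 \<rho> \<in> sets (borel :: 'a measure)" "cball x R \<in> sets borel" by auto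
  have "(\<integral>\<^sup>+s\<in>cball 0 \<rho>. (\<integral>\<^sup>+\<tau>\<in>{0<..t}. k (x + z + s + \<tau> *\<^sub>R v) \<partial>lborel) \<partial>lborel) =
        (\<integral>\<^sup>+s. (\<integral>\<^sup>+\<tau>. k (x + z + s + \<tau> *\<^sub>R v) * indicator {0<..t} \<tau> * indicator (cball 0 \<rho>) s \<partial>lborel) \<partial>lborel)"
    by (subst nn_integral_multc[symmetric]) auto
  also have "\<dots> = (\<integral>\<^sup>+\<tau>. (\<integral>\<^sup>+s. k (x + z + s + \<tau> *\<^sub>R v) * indicator {0<..t} \<tau> * indicator (cball 0 \<rho>) s \<partial>lborel) \<partial>lborel)"
    by (rule lborel_pair.Fubini') measurable
  also have "\<dots> \<le> (\<integral>\<^sup>+\<tau>. (\<integral>\<^sup>+u\<in>cball x R. k u \<partial>lborel) * indicator {0<..t} \<tau> \<partial>lborel)"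
  proof (rule nn_integral_mono)
    fix \<tau> :: real
    show "(\<integral>\<^sup>+s. k (x + z + s + \<tau> *\<^sub>R v) * indicator {0<..t} \<tau> * indicator (cball 0 \<rho>) s \<partial>lborel)
            \<le> (\<integral>\<^sup>+u\<in>cball x R. k u \<partial>lborel) * indicator {0<..t} \<tau>"
    proof (cases "\<tau> \<in> {0<..t}")
      case True
      have "x + z + s + \<tau> *\<^sub>R v \<in> cball x R" if "s \<in> cball 0 \<rho>" for s
      proof -
        have "norm (z + s + \<tau> *\<^sub>R v) \<le> norm z + norm s + \<tau> * norm v"
          using True by (smt (verit) norm_triangle_ineq norm_scaleR greaterThanAtMost_iff)
        moreover have "\<tau> * norm v \<le> t * 1" using True v by (intro mult_mono) auto
        ultimately have "norm (z + s + \<tau> *\<^sub>R v) \<le> R" using R that by simp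
        moreover have "dist x (x + z + s + \<tau> *\<^sub>R v) = norm (z + s + \<tau> *\<^sub>R v)"
          unfolding dist_commute[of x] by (simp add: dist_norm add.assoc)
        ultimately show ?thesis by simp
      qed
      then have "(\<integral>\<^sup>+s. k (x + z + s + \<tau> *\<^sub>R v) * indicator {0<..t} \<tau> * indicator (cball 0 \<rho>) s \<partial>lborel)
          \<le> (\<integral>\<^sup>+s. k ((x + z + \<tau> *\<^sub>R v) + s) * indicator (cball x R) ((x + z + \<tau> *\<^sub>R v) + s) \<partial>lborel)"
        using True by (intro nn_integral_mono) (auto simp: indicator_def algebra_simps)
      also have "\<dots> = (\<integral>\<^sup>+u\<in>cball x R. k u \<partial>lborel)"
        by (rule nn_integral_lborel_translate[where f="\<lambda>u. k u * indicator (cball x R) u"]) measurable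
      finally show ?thesis using True by simp
    qed simp
  qed
  also have "\<dots> = ennreal t * (\<integral>\<^sup>+u\<in>cball x R. k u \<partial>lborel)"
    using t by (subst nn_integral_cmult) (auto simp: mult.commute)
  finally show ?thesis .
qed

text \<open>For negative t the segment is traversed from its other end, whose norm can be larger by
  \<open>\<bar>t\<bar>\<close>; this is why R has to absorb twice that amount.\<close>

lemma nn_integral_ball_increment_le:
  fixes G :: "'a::euclidean_space \<Rightarrow> real" and k :: "'a \<Rightarrow> ennreal"
  assumes k: "k \<in> borel_measurable borel" and G: "G \<in> borel_measurable borel"
    and v: "norm v \<le> 1" and R: "norm z + 2 * \<bar>t\<bar> + \<rho> \<le> R"
    and incr: "\<And>w t. t \<ge> 0 \<Longrightarrow> ennreal \<bar>G (w + t *\<^sub>R v) - G w\<bar> \<le> (\<integral>\<^sup>+\<tau>\<in>{0<..t}. k (w + \<tau> *\<^sub>R v) \<partial>lborel)"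
  shows "(\<integral>\<^sup>+s\<in>cball 0 \<rho>. ennreal \<bar>G (x + (z + t *\<^sub>R v) + s) - G (x + z + s)\<bar> \<partial>lborel)
           \<le> ennreal \<bar>t\<bar> * (\<integral>\<^sup>+u\<in>cball x R. k u \<partial>lborel)"
proof -
  have pos: "(\<integral>\<^sup>+s\<in>cball 0 \<rho>. ennreal \<bar>G (x + (z + t *\<^sub>R v) + s) - G (x + z + s)\<bar> \<partial>lborel)
           \<le> ennreal t * (\<integral>\<^sup>+u\<in>cball x R. k u \<partial>lborel)" if t: "t \<ge> 0" and R: "norm z + t + \<rho> \<le> R" for t z
  proof -
    have "(\<integral>\<^sup>+s\<in>cball 0 \<rho>. ennreal \<bar>G (x + (z + t *\<^sub>R v) + s) - G (x + z + s)\<bar> \<partial>lborel) \<le>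
       (\<integral>\<^sup>+s\<in>cball 0 \<rho>. (\<integral>\<^sup>+\<tau>\<in>{0<..t}. k (x + z + s + \<tau> *\<^sub>R v) \<partial>lborel) \<partial>lborel)"
    proof (intro nn_integral_mono mult_right_mono)
      fix s
      have "x + (z + t *\<^sub>R v) + s = (x + z + s) + t *\<^sub>R v" by (simp add: algebra_simps)
      then show "ennreal \<bar>G (x + (z + t *\<^sub>R v) + s) - G (x + z + s)\<bar> \<le> (\<integral>\<^sup>+\<tau>\<in>{0<..t}. k (x + z + s + \<tau> *\<^sub>R v) \<partial>lborel)"
        using incr[OF t, of "x + z + s"] by (simp only:)
    qed auto
    also have "\<dots> \<le> ennreal t * (\<integral>\<^sup>+u\<in>cball x R. k u \<partial>lborel)"
      by (rule nn_integral_ball_segment_le[OF k v t R])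
    finally show ?thesis .
  qed
  show ?thesis
  proof (cases "t \<ge> 0")
    case True
    then show ?thesis using pos[OF True, of z] R by simp
  next
    case False
    have "norm (z + t *\<^sub>R v) \<le> norm z + norm (t *\<^sub>R v)" by (rule norm_triangle_ineq)
    also have "norm (t *\<^sub>R v) \<le> \<bar>t\<bar> * 1" unfolding norm_scaleR using v by (intro mult_left_mono) auto
    finally have "norm (z + t *\<^sub>R v) + (- t) + \<rho> \<le> R" using R False by simp
    then show ?thesis using pos[of "- t" "z + t *\<^sub>R v"] False
      by (simp add: abs_minus_commute)
  qed
qed

text \<open>The way from x to x + y is taken along the coordinate axes, one basis vector at a time.
  Partial sums have norm at most \<open>DIM('a) * norm y\<close>, and the next leg needs another 2 *
  norm y, which explains the factor \<open>DIM('a) + 2\<close>.\<close>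

lemma nn_integral_ball_telescope:
  fixes G :: "'a::euclidean_space \<Rightarrow> real" and k :: "'a \<Rightarrow> 'a \<Rightarrow> ennreal"
  assumes k: "\<And>b. b \<in> Basis \<Longrightarrow> k b \<in> borel_measurable borel" and G[measurable]: "G \<in> borel_measurable borel"
    and incr: "\<And>b w t. b \<in> Basis \<Longrightarrow> t \<ge> 0 \<Longrightarrow> ennreal \<bar>G (w + t *\<^sub>R b) - G w\<bar> \<le> (\<integral>\<^sup>+\<tau>\<in>{0<..t}. k b (w + \<tau> *\<^sub>R b) \<partial>lborel)"
    and I: "\<And>b. b \<in> Basis \<Longrightarrow> (\<integral>\<^sup>+u\<in>cball x R. k b u \<partial>lborel) \<le> ennreal I" and I0: "I \<ge> 0"
    and R: "(DIM('a) + 2) * norm y + \<rho> \<le> R"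
  shows "(\<integral>\<^sup>+s\<in>cball 0 \<rho>. ennreal \<bar>G (x + y + s) - G (x + s)\<bar> \<partial>lborel) \<le> ennreal (DIM('a) * norm y * I)"
proof -
  have [measurable]: "cball 0 \<rho> \<in> sets (borel :: 'a measure)" by auto
  define Y where "Y T = (\<Sum>b\<in>T. (y \<bullet> b) *\<^sub>R b)" for T
  have "(\<integral>\<^sup>+s\<in>cball 0 \<rho>. ennreal \<bar>G (x + Y T + s) - G (x + s)\<bar> \<partial>lborel) \<le> ennreal (card T * norm y * I)"
    if "finite T" "T \<subseteq> Basis" for T
    using that
  proof (induction T rule: finite_induct)
    case empty
    then show ?case by (simp add: Y_def)
  next
    case (insert b T)
    have b: "b \<in> Basis" and T: "T \<subseteq> Basis" using insert by auto
    have Yb: "Y (insert b T) = Y T + (y \<bullet> b) *\<^sub>R b" using insert by (simp add: Y_def add.commute)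
    have "norm (Y T) \<le> (\<Sum>b\<in>T. norm y)"
      unfolding Y_def
    proof (rule sum_norm_le)
      fix c assume "c \<in> T"
      then have "c \<in> Basis" using T by blast
      then show "norm ((y \<bullet> c) *\<^sub>R c) \<le> norm y" using Basis_le_norm by simp
    qed
    also have "\<dots> \<le> DIM('a) * norm y" using T by (simp add: card_mono mult_right_mono)
    finally have "norm (Y T) + 2 * \<bar>y \<bullet> b\<bar> + \<rho> \<le> R"
      using R Basis_le_norm[OF b, of y] by (simp add: algebra_simps)
    then have 1: "(\<integral>\<^sup>+s\<in>cball 0 \<rho>. ennreal \<bar>G (x + (Y T + (y \<bullet> b) *\<^sub>R b) + s) - G (x + Y T + s)\<bar> \<partial>lborel)
           \<le> ennreal \<bar>y \<bullet> b\<bar> * (\<integral>\<^sup>+u\<in>cball x R. k b u \<partial>lborel)"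
      using b by (intro nn_integral_ball_increment_le[OF k[OF b] G] incr) auto
    also have "\<dots> \<le> ennreal (norm y) * ennreal I"
      using I[OF b] Basis_le_norm[OF b, of y] by (intro mult_mono ennreal_leI) auto
    finally have 2: "(\<integral>\<^sup>+s\<in>cball 0 \<rho>. ennreal \<bar>G (x + (Y T + (y \<bullet> b) *\<^sub>R b) + s) - G (x + Y T + s)\<bar> \<partial>lborel)
           \<le> ennreal (norm y * I)" by (simp add: ennreal_mult I0)
    have "(\<integral>\<^sup>+s\<in>cball 0 \<rho>. ennreal \<bar>G (x + Y (insert b T) + s) - G (x + s)\<bar> \<partial>lborel) \<le>
      (\<integral>\<^sup>+s. ennreal \<bar>G (x + (Y T + (y \<bullet> b) *\<^sub>R b) + s) - G (x + Y T + s)\<bar> * indicator (cball 0 \<rho>) s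
         + ennreal \<bar>G (x + Y T + s) - G (x + s)\<bar> * indicator (cball 0 \<rho>) s \<partial>lborel)"
      unfolding Yb by (intro nn_integral_mono) (auto simp: indicator_def intro!: ennreal_leI simp flip: ennreal_plus)
    also have "\<dots> = (\<integral>\<^sup>+s\<in>cball 0 \<rho>. ennreal \<bar>G (x + (Y T + (y \<bullet> b) *\<^sub>R b) + s) - G (x + Y T + s)\<bar> \<partial>lborel)
         + (\<integral>\<^sup>+s\<in>cball 0 \<rho>. ennreal \<bar>G (x + Y T + s) - G (x + s)\<bar> \<partial>lborel)"
      by (rule nn_integral_add) measurable
    also have "\<dots> \<le> ennreal (norm y * I) + ennreal (card T * norm y * I)"
      using 2 insert.IH[OF T] by (rule add_mono)
    also have "\<dots> = ennreal (card (insert b T) * norm y * I)"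
      using insert I0 by (simp add: algebra_simps flip: ennreal_plus)
    finally show ?case .
  qed
  from this[of Basis] show ?thesis by (simp add: Y_def euclidean_representation)
qed

text \<open>Shifting both x + y and x by s changes each value of G by at most L * \<rho>, so the
  unshifted increment exceeds every shifted one, and hence their mean, by at most 2 * L *
  \<rho>.\<close>

lemma increment_le_ball_average:
  fixes G :: "'a::euclidean_space \<Rightarrow> real"
  assumes L: "L-lipschitz_on UNIV G" and \<rho>: "\<rho> > 0" and C: "C \<ge> 0"
    and av: "(\<integral>\<^sup>+s\<in>cball 0 \<rho>. ennreal \<bar>G (x + y + s) - G (x + s)\<bar> \<partial>lborel) \<le> ennreal (C * measure lborel (cball (0::'a) \<rho>))"
  shows "\<bar>G (x + y) - G x\<bar> \<le> C + 2 * L * \<rho>"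
proof -
  have [measurable]: "cball 0 \<rho> \<in> sets (borel :: 'a measure)" by auto
  have [measurable]: "G \<in> borel_measurable borel"
    using L by (intro borel_measurable_continuous_onI lipschitz_on_continuous_on)
  have L0: "L \<ge> 0" using L by (rule lipschitz_on_nonneg)
  let ?m = "measure lborel (cball (0::'a) \<rho>)"
  have m: "?m > 0" using \<rho> by (simp add: content_cball_pos)
  have em: "emeasure lborel (cball (0::'a) \<rho>) = ennreal ?m"
    using emeasure_lborel_cball_finite[of "0::'a" \<rho>] by (intro emeasure_eq_ennreal_measure) auto
  have "ennreal (\<bar>G (x + y) - G x\<bar> * ?m) = (\<integral>\<^sup>+s\<in>cball (0::'a) \<rho>. ennreal \<bar>G (x + y) - G x\<bar> \<partial>lborel)"
    by (simp add: nn_integral_cmult_indicator em ennreal_mult)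
  also have "\<dots> \<le> (\<integral>\<^sup>+s. ennreal \<bar>G (x + y + s) - G (x + s)\<bar> * indicator (cball 0 \<rho>) s
        + ennreal (2 * L * \<rho>) * indicator (cball 0 \<rho>) s \<partial>lborel)"
  proof (rule nn_integral_mono)
    fix s :: 'a
    have "\<bar>G (x + y) - G x\<bar> \<le> \<bar>G (x + y + s) - G (x + s)\<bar> + 2 * L * \<rho>" if s: "s \<in> cball 0 \<rho>"
    proof -
      have "\<bar>G (w + s) - G w\<bar> \<le> L * \<rho>" for w
      proof -
        have "\<bar>G (w + s) - G w\<bar> \<le> L * norm s"
          using lipschitz_onD[OF L, of "w + s" w] by (simp add: dist_norm)
        also have "\<dots> \<le> L * \<rho>" using s L0 by (intro mult_left_mono) auto
        finally show ?thesis .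
      qed
      from this[of "x + y"] this[of x] show ?thesis by linarith
    qed
    then show "ennreal \<bar>G (x + y) - G x\<bar> * indicator (cball 0 \<rho>) s \<le> ennreal \<bar>G (x + y + s) - G (x + s)\<bar> * indicator (cball 0 \<rho>) s
        + ennreal (2 * L * \<rho>) * indicator (cball 0 \<rho>) s"
      using L0 \<rho> by (auto simp: indicator_def intro!: ennreal_leI simp flip: ennreal_plus)
  qed
  also have "\<dots> = (\<integral>\<^sup>+s\<in>cball 0 \<rho>. ennreal \<bar>G (x + y + s) - G (x + s)\<bar> \<partial>lborel) + ennreal (2 * L * \<rho>) * ennreal ?m"
    by (subst nn_integral_add) (auto simp: nn_integral_cmult_indicator em)
  also have "\<dots> \<le> ennreal (C * ?m) + ennreal (2 * L * \<rho>) * ennreal ?m"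
    using av by (rule add_right_mono)
  also have "\<dots> = ennreal ((C + 2 * L * \<rho>) * ?m)"
    using C L0 \<rho> by (simp add: algebra_simps flip: ennreal_plus ennreal_mult)
  finally have "\<bar>G (x + y) - G x\<bar> * ?m \<le> (C + 2 * L * \<rho>) * ?m"
    using C L0 \<rho> by (subst (asm) ennreal_le_iff) auto
  then show ?thesis using m by simp
qed

text \<open>Subtracting the candidate linear part leaves G, whose increments along the axes are
  controlled by the deviation of the slopes from their values at x, which is small in mean near x.
  Averaging uses a ball of radius proportional to norm y: small enough for the Lipschitz error, yet
  large enough to keep its volume comparable to that of \<open>cball x R\<close>.\<close>

lemma lebesgue_point_slopes_imp_GDERIV:
  fixes g :: "'a::euclidean_space \<Rightarrow> real"
  assumes L: "L-lipschitz_on UNIV g"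
    and leb: "\<And>b e. b \<in> Basis \<Longrightarrow> e > 0 \<Longrightarrow> \<exists>d>0. \<forall>r. 0 < r \<and> r < d \<longrightarrow>
           (\<integral>u\<in>cball x r. \<bar>right_slope L g b u - right_slope L g b x\<bar> \<partial>lborel) \<le> e * measure lborel (cball x r)"
  shows "GDERIV g x :> (\<Sum>b\<in>Basis. right_slope L g b x *\<^sub>R b)"
proof -
  have L0: "L \<ge> 0" using L by (rule lipschitz_on_nonneg)
  let ?n = "real DIM('a)"
  have n: "?n \<ge> 1" by (simp add: Suc_leI)
  define h where "h = right_slope L g"
  have [measurable]: "h b \<in> borel_measurable borel" for b
    unfolding h_def using L by (rule borel_measurable_right_slope)
  have hL: "\<bar>h b u\<bar> \<le> L" for b u unfolding h_def using L0 by (rule abs_right_slope)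
  define D where "D = (\<Sum>b\<in>Basis. h b x *\<^sub>R b)"
  have Db: "D \<bullet> b = h b x" if "b \<in> Basis" for b
    using that by (simp add: D_def inner_sum_left inner_Basis if_distrib cong: if_cong)
  define G where "G w = g w - D \<bullet> w" for w
  define M where "M = L + norm D"
  have GM: "M-lipschitz_on UNIV G"
  proof (rule lipschitz_onI)
    fix u w :: 'a
    have "\<bar>g u - g w\<bar> \<le> L * dist u w" using lipschitz_onD[OF L, of u w] by (simp add: dist_real_def)
    moreover have "\<bar>D \<bullet> u - D \<bullet> w\<bar> \<le> norm D * dist u w"
      using Cauchy_Schwarz_ineq2[of D "u - w"] by (simp add: inner_diff_right dist_norm)
    ultimately show "dist (G u) (G w) \<le> M * dist u w"
      by (simp add: G_def M_def dist_real_def algebra_simps)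
  qed (simp add: M_def L0)
  have M0: "M \<ge> 0" using GM by (rule lipschitz_on_nonneg)
  have [measurable]: "G \<in> borel_measurable borel"
    using GM by (intro borel_measurable_continuous_onI lipschitz_on_continuous_on)
  define k where "k b u = ennreal \<bar>h b u - h b x\<bar>" for b u
  have k[measurable]: "k b \<in> borel_measurable borel" for b unfolding k_def by measurable
  have hb: "\<bar>h b u - h b x\<bar> \<le> 2 * L" for b u using hL[of b u] hL[of b x] by linarith
  have incr: "ennreal \<bar>G (w + t *\<^sub>R b) - G w\<bar> \<le> (\<integral>\<^sup>+\<tau>\<in>{0<..t}. k b (w + \<tau> *\<^sub>R b) \<partial>lborel)"
    if b: "b \<in> Basis" and t: "t \<ge> 0" for b w t
  proof -
    let ?f = "\<lambda>s. indicat_real {0<..t} s * (h b (w + s *\<^sub>R b) - h b x)"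
    have i1: "integrable lborel (\<lambda>s. indicat_real {0<..t} s * h b (w + s *\<^sub>R b))"
      by (rule integrableI_bounded_set[where A="{0<..t}" and B=L]) (use t hL in \<open>auto simp: indicator_def\<close>)
    have i2: "integrable lborel (\<lambda>s. indicat_real {0<..t} s * h b x)"
      using t by (intro integrable_mult_left integrable_real_indicator) auto
    have "g (w + t *\<^sub>R b) - g w = (\<integral>s. indicat_real {0<..t} s * h b (w + s *\<^sub>R b) \<partial>lborel)"
      using lipschitz_integral_slope[OF L, of b 0 t w] b t by (simp add: h_def set_lebesgue_integral_def)
    then have "G (w + t *\<^sub>R b) - G w = (\<integral>s. ?f s \<partial>lborel)"
      using i1 i2 t Db[OF b] by (simp add: G_def right_diff_distrib inner_add_right)
    moreover have "integrable lborel ?f" using i1 i2 by (simp add: right_diff_distrib)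
    ultimately have "ennreal \<bar>G (w + t *\<^sub>R b) - G w\<bar> \<le> (\<integral>\<^sup>+s. ennreal (norm (?f s)) \<partial>lborel)"
      using integral_norm_bound_ennreal[of lborel ?f] by simp
    also have "\<dots> = (\<integral>\<^sup>+\<tau>\<in>{0<..t}. k b (w + \<tau> *\<^sub>R b) \<partial>lborel)"
      by (intro nn_integral_cong) (auto simp: k_def indicator_def)
    finally show ?thesis .
  qed
  have main: "\<exists>d>0. \<forall>y. norm (y - x) < d \<longrightarrow> norm (g y - g x - (y - x) \<bullet> D) \<le> e * norm (y - x)" if e: "e > 0" for e
  proof -
    \<comment> \<open>The order of choices matters: \<delta> makes the Lipschitz error 2 * M *
      \<rho> at most e / 2 * norm y, this fixes the volume ratio c, and \<epsilon> is chosen last to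
      compensate for c.\<close>
    define \<delta> where "\<delta> = min 1 (e / (4 * (M + 1)))"
    have \<delta>: "0 < \<delta>" "\<delta> \<le> 1" "2 * M * \<delta> \<le> e / 2"
    proof -
      show "0 < \<delta>" "\<delta> \<le> 1" using e M0 by (auto simp: \<delta>_def)
      have "2 * M * \<delta> \<le> 2 * M * (e / (4 * (M + 1)))" using M0 by (intro mult_left_mono) (auto simp: \<delta>_def)
      also have "\<dots> \<le> e / 2" using M0 e by (simp add: field_simps)
      finally show "2 * M * \<delta> \<le> e / 2" .
    qed
    define c where "c = ((?n + 3) / \<delta>) ^ DIM('a)"
    have c: "c > 0" using \<delta> by (simp add: c_def add_nonneg_pos)
    define \<epsilon> where "\<epsilon> = e / (2 * ?n * c)"
    have \<epsilon>: "\<epsilon> > 0" using e c by (simp add: \<epsilon>_def)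
    have "\<forall>b\<in>Basis. \<exists>d>0. \<forall>r. 0 < r \<and> r < d \<longrightarrow>
           (\<integral>u\<in>cball x r. \<bar>h b u - h b x\<bar> \<partial>lborel) \<le> \<epsilon> * measure lborel (cball x r)"
      using leb \<epsilon> by (auto simp: h_def)
    then obtain dd where dd: "\<And>b. b \<in> Basis \<Longrightarrow> dd b > 0" "\<And>b r. b \<in> Basis \<Longrightarrow> 0 < r \<Longrightarrow> r < dd b \<Longrightarrow>
           (\<integral>u\<in>cball x r. \<bar>h b u - h b x\<bar> \<partial>lborel) \<le> \<epsilon> * measure lborel (cball x r)"
      by metis
    define d where "d = Min (dd ` Basis)"
    have d: "d > 0" "\<And>b. b \<in> Basis \<Longrightarrow> d \<le> dd b" using dd(1) by (auto simp: d_def)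
    have est: "\<bar>G (x + y) - G x\<bar> \<le> e * norm y" if y: "norm y < d / (?n + 3)" "y \<noteq> 0" for y
    proof -
      \<comment> \<open>The factor exceeds that of the telescoping estimate by one, because \<rho>
        is at most norm y.\<close>
      define R where "R = (?n + 3) * norm y"
      define \<rho> where "\<rho> = \<delta> * norm y"
      have R: "0 < R" "R < d" using y n by (auto simp: R_def field_simps intro: add_pos_pos)
      have \<rho>: "\<rho> > 0" "\<rho> \<le> norm y" using y \<delta> by (auto simp: \<rho>_def mult_left_le_one_le)
      have Rr: "R = ((?n + 3) / \<delta>) * \<rho>" using \<delta> by (simp add: R_def \<rho>_def)
      let ?m = "measure lborel (cball (0::'a) \<rho>)"
      have mR: "measure lborel (cball x R) = c * ?m"
      proof -
        have "R ^ DIM('a) = c * \<rho> ^ DIM('a)" unfolding Rr c_def by (rule power_mult_distrib)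
        then show ?thesis using R \<rho> by (simp add: content_cball)
      qed
      have I: "(\<integral>\<^sup>+u\<in>cball x R. k b u \<partial>lborel) \<le> ennreal (\<epsilon> * (c * ?m))" if b: "b \<in> Basis" for b
      proof -
        have "integrable lborel (\<lambda>u. indicat_real (cball x R) u * \<bar>h b u - h b x\<bar>)"
        proof (rule integrableI_bounded_set[where A="cball x R" and B="2 * L"])
          show "(\<lambda>u. indicat_real (cball x R) u * \<bar>h b u - h b x\<bar>) \<in> borel_measurable lborel"
            by (intro borel_measurable_times borel_measurable_indicator borel_measurable_abs borel_measurable_diff) auto
          show "emeasure lborel (cball x R) < \<infinity>" by (rule emeasure_lborel_cball_finite)
        qed (use hb in \<open>auto simp: indicator_def\<close>)
        then have "(\<integral>\<^sup>+u. ennreal (indicat_real (cball x R) u * \<bar>h b u - h b x\<bar>) \<partial>lborel)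
            = ennreal (\<integral>u. indicat_real (cball x R) u * \<bar>h b u - h b x\<bar> \<partial>lborel)"
          by (rule nn_integral_eq_integral) simp
        also have "\<dots> \<le> ennreal (\<epsilon> * (c * ?m))"
          using dd(2)[OF b R(1)] R(2) d(2)[OF b] by (intro ennreal_leI) (simp add: set_lebesgue_integral_def mR)
        finally show ?thesis
          by (rule order_trans[rotated]) (auto intro!: nn_integral_mono simp: k_def indicator_def)
      qed
      have "(\<integral>\<^sup>+s\<in>cball 0 \<rho>. ennreal \<bar>G (x + y + s) - G (x + s)\<bar> \<partial>lborel) \<le> ennreal (?n * norm y * (\<epsilon> * (c * ?m)))"
      proof (rule nn_integral_ball_telescope[OF k _ incr I])
        show "0 \<le> \<epsilon> * (c * ?m)" using \<epsilon> c by simp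
        show "real (DIM('a) + 2) * norm y + \<rho> \<le> R" using \<rho> by (simp add: R_def algebra_simps)
      qed auto
      also have "?n * norm y * (\<epsilon> * (c * ?m)) = (e / 2 * norm y) * ?m"
        using c n by (simp add: \<epsilon>_def field_simps)
      finally have "\<bar>G (x + y) - G x\<bar> \<le> e / 2 * norm y + 2 * M * \<rho>"
        using e by (intro increment_le_ball_average[OF GM \<rho>(1)]) auto
      also have "2 * M * \<rho> = (2 * M * \<delta>) * norm y" by (simp add: \<rho>_def)
      also have "\<dots> \<le> e / 2 * norm y" using \<delta>(3) by (rule mult_right_mono) simp
      finally show ?thesis by simp
    qed
    show ?thesis
    proof (intro exI[of _ "d / (?n + 3)"] conjI allI impI)
      show "d / (?n + 3) > 0" using d n by simp
      fix y assume y: "norm (y - x) < d / (?n + 3)"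
      show "norm (g y - g x - (y - x) \<bullet> D) \<le> e * norm (y - x)"
      proof (cases "y = x")
        case False
        then show ?thesis using est[OF y] by (simp add: G_def inner_diff_left inner_diff_right inner_commute algebra_simps)
      qed simp
    qed
  qed
  have "GDERIV g x :> D"
    unfolding gderiv_def has_derivative_at_alt using main by (simp add: bounded_linear_inner_left)
  then show ?thesis by (simp add: D_def h_def)
qed

theorem rademacher:
  fixes g :: "'a::euclidean_space \<Rightarrow> real"
  assumes L: "L-lipschitz_on UNIV g"
  shows "AE x in lborel. GDERIV g x :> (\<Sum>b\<in>Basis. right_slope L g b x *\<^sub>R b)"
proof -
  have L0: "L \<ge> 0" using L by (rule lipschitz_on_nonneg)
  have "AE x in lborel. \<forall>b\<in>Basis. \<forall>e>0. \<exists>d>0. \<forall>r. 0 < r \<and> r < d \<longrightarrow>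
           (\<integral>u\<in>cball x r. \<bar>right_slope L g b u - right_slope L g b x\<bar> \<partial>lborel) \<le> e * measure lborel (cball x r)"
    by (intro AE_finite_allI lebesgue_points[where M=L] borel_measurable_right_slope[OF L] abs_right_slope[OF L0]) auto
  then show ?thesis
    by eventually_elim (intro lebesgue_point_slopes_imp_GDERIV[OF L], blast)
qed

subsection \<open>Increments and Clarke gradients\<close>

lemma AE_lborel_in_open:
  fixes U :: "'a::euclidean_space set"
  assumes "AE x in lborel. P x" "open U" "U \<noteq> {}"
  obtains x where "x \<in> U" "P x"
proof -
  obtain N where N: "N \<in> null_sets lborel" "{x. \<not> P x} \<subseteq> N"
    using assms(1) by (auto simp: eventually_ae_filter)
  have "negligible N" using N(1) by (simp add: negligible_iff_null_sets null_sets_completionI)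
  then have "\<not> U \<subseteq> N" using open_not_negligible[OF assms(2,3)] negligible_subset by blast
  then show thesis using that N(2) by blast
qed

text \<open>For fixed s the bad z lie in a translate of a null set, and Fubini's theorem
  interchanges the two quantifiers. The bad set is first enclosed in a Borel null set, as P itself
  may fail to be measurable.\<close>

lemma AE_lborel_lines:
  fixes v :: "'a::euclidean_space"
  assumes "AE x in lborel. P x"
  shows "AE z in lborel. AE s in (lborel :: real measure). P (z + s *\<^sub>R v)"
proof -
  obtain N where N: "N \<in> null_sets lborel" "{x. \<not> P x} \<subseteq> N"
    using assms by (auto simp: eventually_ae_filter)
  then have [measurable]: "N \<in> sets borel" by auto
  have "AE s in (lborel :: real measure). AE z in lborel. z + s *\<^sub>R v \<notin> N"
  proof (rule AE_I2)
    fix s :: real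
    have "(\<integral>\<^sup>+z. indicator N (s *\<^sub>R v + z) \<partial>lborel) = (\<integral>\<^sup>+z. indicator N z \<partial>lborel)"
      by (rule nn_integral_lborel_translate) measurable
    also have "\<dots> = 0" using N by (simp add: null_sets_def)
    finally have "AE z in lborel. indicator N (s *\<^sub>R v + z) = (0 :: ennreal)"
      by (subst (asm) nn_integral_0_iff_AE) auto
    then show "AE z in lborel. z + s *\<^sub>R v \<notin> N"
      by eventually_elim (auto simp: indicator_def add.commute split: if_splits)
  qed
  moreover have "{p \<in> space (lborel \<Otimes>\<^sub>M lborel). snd p + fst p *\<^sub>R v \<notin> N} \<in> sets ((lborel :: real measure) \<Otimes>\<^sub>M lborel)"
    by measurable
  ultimately have "AE z in lborel. AE s in (lborel :: real measure). z + s *\<^sub>R v \<notin> N"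
    by (subst (asm) lborel_pair.AE_commute) auto
  then show ?thesis
    by eventually_elim (use N(2) in \<open>auto elim!: eventually_mono\<close>)
qed

section \<open>Gradients and directional slopes\<close>

lemma GDERIV_unique: "GDERIV f x :> D \<Longrightarrow> GDERIV f x :> E \<Longrightarrow> D = E"
  unfolding gderiv_def by (metis has_derivative_unique inner_commute vector_eq_ldot)

lemma gradient_eqI: "GDERIV f x :> D \<Longrightarrow> gradient f x = D"
  unfolding gradient_def using GDERIV_unique by blast

lemma differentiable_imp_GDERIV:
  fixes f :: "'a::euclidean_space \<Rightarrow> real"
  assumes "f differentiable (at x)"
  shows "GDERIV f x :> gradient f x"
proof -
  obtain f' where f': "(f has_derivative f') (at x)" using assms by (auto simp: differentiable_def)
  then interpret linear f' by (rule has_derivative_linear)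
  have "f' h = h \<bullet> (\<Sum>b\<in>Basis. f' b *\<^sub>R b)" for h
  proof -
    have "f' h = f' (\<Sum>b\<in>Basis. (h \<bullet> b) *\<^sub>R b)" by (simp add: euclidean_representation)
    also have "\<dots> = (\<Sum>b\<in>Basis. (h \<bullet> b) * f' b)" by (simp add: sum scaleR)
    also have "\<dots> = h \<bullet> (\<Sum>b\<in>Basis. f' b *\<^sub>R b)" by (simp add: inner_sum_right mult.commute)
    finally show ?thesis .
  qed
  then have "f' = (\<lambda>h. h \<bullet> (\<Sum>b\<in>Basis. f' b *\<^sub>R b))" by blast
  then have "GDERIV f x :> (\<Sum>b\<in>Basis. f' b *\<^sub>R b)" using f' by (simp add: gderiv_def)
  then show ?thesis using gradient_eqI by metis
qed

lemma GDERIV_directional: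
  assumes "GDERIV f x :> D"
  shows "((\<lambda>t. (f (x + t *\<^sub>R v) - f x) / t) \<longlongrightarrow> v \<bullet> D) (at 0)"
proof -
  have "((\<lambda>t. f (x + t *\<^sub>R v)) has_derivative (\<lambda>t. (t *\<^sub>R v) \<bullet> D)) (at (0::real))"
    by (rule has_derivative_compose[where g=f and f="\<lambda>t. x + t *\<^sub>R v"])
       (use assms in \<open>auto intro!: derivative_eq_intros simp: gderiv_def\<close>)
  then have "DERIV (\<lambda>t. f (x + t *\<^sub>R v)) 0 :> v \<bullet> D"
    unfolding has_field_derivative_def by (rule has_derivative_eq_rhs) (auto simp: fun_eq_iff)
  then show ?thesis by (simp add: DERIV_def)
qed

text \<open>The directional derivative along D itself is the square of norm D, while the Lipschitz
  condition bounds it by L * norm D.\<close>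

lemma norm_GDERIV_le:
  assumes D: "GDERIV f x :> D" and L: "L-lipschitz_on (ball x e) f" and e: "e > 0"
  shows "norm D \<le> L"
proof -
  have L0: "L \<ge> 0" using L by (rule lipschitz_on_nonneg)
  have lim: "((\<lambda>t. (f (x + t *\<^sub>R D) - f x) / t) \<longlongrightarrow> D \<bullet> D) (at_right 0)"
    using GDERIV_directional[OF D] by (rule tendsto_mono[rotated]) (simp add: at_le)
  have "\<forall>\<^sub>F t in at_right 0. (f (x + t *\<^sub>R D) - f x) / t \<le> L * norm D"
    unfolding eventually_at_right_field
  proof (intro exI[of _ "e / (norm D + 1)"] conjI allI impI)
    show "0 < e / (norm D + 1)" using e by (simp add: add_nonneg_pos)
    fix t :: real assume t: "0 < t" "t < e / (norm D + 1)"
    have "t * norm D \<le> t * (norm D + 1)" using t by simp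
    also have "\<dots> < e" using t by (simp add: pos_less_divide_eq add_nonneg_pos)
    finally have "x + t *\<^sub>R D \<in> ball x e" using t by (simp add: dist_norm)
    then have "f (x + t *\<^sub>R D) - f x \<le> L * (t * norm D)"
      using lipschitz_onD[OF L, of "x + t *\<^sub>R D" x] e t by (simp add: dist_norm)
    then show "(f (x + t *\<^sub>R D) - f x) / t \<le> L * norm D" using t by (simp add: field_simps)
  qed
  then have "D \<bullet> D \<le> L * norm D" by (rule tendsto_upperbound[OF lim]) simp
  then have "norm D * norm D \<le> L * norm D" by (simp add: power2_norm_eq_inner flip: power2_eq_square)
  then show ?thesis using L0 by (cases "D = 0") auto
qed

lemma right_slope_eq:
  assumes D: "GDERIV f x :> D" and "\<bar>v \<bullet> D\<bar> \<le> L"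
  shows "right_slope L f v x = v \<bullet> D"
proof -
  have "filterlim (\<lambda>k. 1 / real (Suc k)) (at 0) sequentially"
    by (rule filterlim_atI) (use LIMSEQ_Suc[OF lim_1_over_n] in simp_all)
  from filterlim_compose[OF GDERIV_directional[OF D] this]
  have "(\<lambda>k. (f (x + (1 / Suc k) *\<^sub>R v) - f x) / (1 / Suc k)) \<longlonglongrightarrow> v \<bullet> D" .
  then have "lim (\<lambda>k. (f (x + (1 / Suc k) *\<^sub>R v) - f x) * real (Suc k)) = v \<bullet> D"
    by (intro limI) simp
  then show ?thesis using assms(2) by (auto simp: right_slope_def)
qed

text \<open>Almost every point is a point of differentiability on almost every line of direction \<open>v\<close>.\<close>

lemma lipschitz_increment_le:
  fixes g :: "'a::euclidean_space \<Rightarrow> real"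
  assumes L: "L-lipschitz_on UNIV g" and U: "open U" "convex U"
    and bd: "\<And>u D. u \<in> U \<Longrightarrow> GDERIV g u :> D \<Longrightarrow> v \<bullet> D \<le> c"
    and z: "z \<in> U" "z + t *\<^sub>R v \<in> U" and t: "t \<ge> 0"
  shows "g (z + t *\<^sub>R v) - g z \<le> t * c"
proof -
  have unit: "g (z + t *\<^sub>R v) - g z \<le> t * c"
    if bd: "\<And>u D. u \<in> U \<Longrightarrow> GDERIV g u :> D \<Longrightarrow> v \<bullet> D \<le> c"
      and z: "z \<in> U" "z + t *\<^sub>R v \<in> U" and t: "t \<ge> 0" and v: "norm v \<le> 1" for v c z and t :: real
  proof (rule ccontr)
    assume neg: "\<not> ?thesis"
    have cg: "continuous_on UNIV g" using L by (rule lipschitz_on_continuous_on)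
    have cg': "continuous_on A g" for A using cg continuous_on_subset by blast
    \<comment> \<open>The line through z itself may consist of bad points. A strict violation is an
      open condition, so it also occurs at some y whose line is good almost everywhere.\<close>
    let ?W = "U \<inter> (\<lambda>y. y + t *\<^sub>R v) -` U \<inter> {y. t * c < g (y + t *\<^sub>R v) - g y}"
    have W: "open ?W"
      using U(1) by (intro open_Int open_vimage open_Collect_less continuous_intros continuous_on_compose2[OF cg]) auto
    have zW: "z \<in> ?W" using z neg by simp
    have ae: "AE y in lborel. AE s in lborel. \<exists>D. GDERIV g (y + s *\<^sub>R v) :> D"
      by (rule AE_lborel_lines) (use rademacher[OF L] in \<open>auto elim!: eventually_mono\<close>)
    obtain y where y: "y \<in> ?W" "AE s in lborel. \<exists>D. GDERIV g (y + s *\<^sub>R v) :> D"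
      using AE_lborel_in_open[OF ae W] zW by blast
    have "g (y + t *\<^sub>R v) - g y = (\<integral>s\<in>{0<..t}. right_slope L g v (y + s *\<^sub>R v) \<partial>lborel)"
      using lipschitz_integral_slope[OF L v t, of y] by simp
    also have "\<dots> \<le> (\<integral>s. indicat_real {0<..t} s * c \<partial>lborel)"
      unfolding set_lebesgue_integral_def
    proof (rule integral_mono_AE)
      have [measurable]: "right_slope L g v \<in> borel_measurable borel" using L by (rule borel_measurable_right_slope)
      show "integrable lborel (\<lambda>s. indicat_real {0<..t} s *\<^sub>R right_slope L g v (y + s *\<^sub>R v))"
        by (rule integrableI_bounded_set[where A="{0<..t}" and B=L])
           (use t abs_right_slope[OF lipschitz_on_nonneg[OF L]] in \<open>auto simp: indicator_def\<close>)
      show "integrable lborel (\<lambda>s. indicat_real {0<..t} s * c)"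
        using t by (intro integrable_mult_left integrable_real_indicator) auto
      show "AE s in lborel. indicat_real {0<..t} s *\<^sub>R right_slope L g v (y + s *\<^sub>R v) \<le> indicat_real {0<..t} s * c"
        using y(2)
      proof eventually_elim
        case (elim s)
        then obtain D where D: "GDERIV g (y + s *\<^sub>R v) :> D" by blast
        have "norm D \<le> L"
          by (rule norm_GDERIV_le[OF D, where e=1]) (use lipschitz_on_subset[OF L subset_UNIV] in auto)
        then have "\<bar>v \<bullet> D\<bar> \<le> L"
          using Cauchy_Schwarz_ineq2[of v D] mult_mono[OF v order_refl, of "norm D"] by simp
        then have eq: "right_slope L g v (y + s *\<^sub>R v) = v \<bullet> D" by (rule right_slope_eq[OF D])
        show ?case
        proof (cases "s \<in> {0<..t}")
          case True
          have "y + s *\<^sub>R v = (1 - s / t) *\<^sub>R y + (s / t) *\<^sub>R (y + t *\<^sub>R v)"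
            using True by (simp add: algebra_simps)
          also have "\<dots> \<in> U" using y(1) True by (intro convexD[OF U(2)]) auto
          finally have "v \<bullet> D \<le> c" using D by (rule bd)
          then show ?thesis by (simp add: eq mult_left_mono)
        qed simp
      qed
    qed
    also have "\<dots> = t * c" using t by simp
    finally show False using y(1) by simp
  qed
  \<comment> \<open>The integral formula for slopes is stated for vectors of norm at most 1, so v is
    shortened by R and t lengthened accordingly. The maximum with 1 keeps R positive when v =
    0.\<close>
  define R where "R = max 1 (norm v)"
  have R: "R > 0" "norm v \<le> R" by (auto simp: R_def)
  have "g (z + (t * R) *\<^sub>R ((1 / R) *\<^sub>R v)) - g z \<le> (t * R) * (c / R)"
  proof (rule unit)
    show "(1 / R) *\<^sub>R v \<bullet> D \<le> c / R" if "u \<in> U" "GDERIV g u :> D" for u D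
      using bd[OF that] R by (simp add: divide_right_mono)
  qed (use R z t in auto)
  then show ?thesis using R by simp
qed

text \<open>The nearest-point projection onto a closed convex set is nonexpansive, so composing with
  it keeps the constant. This gives access to Rademacher's theorem and the increment bound, both
  stated for globally Lipschitz functions.\<close>

lemma lipschitz_extension_from_ball:
  fixes g :: "'a::euclidean_space \<Rightarrow> 'b::metric_space"
  assumes L: "L-lipschitz_on (ball x e) g" and e: "e > 0"
  obtains g' where "L-lipschitz_on UNIV g'" "\<And>z. z \<in> ball x (e / 2) \<Longrightarrow> g' z = g z"
proof
  let ?p = "closest_point (cball x (e / 2))"
  have p: "?p z \<in> cball x (e / 2)" for z using e by (intro closest_point_in_set) auto
  have sub: "cball x (e / 2) \<subseteq> ball x e" using e by (auto simp: field_simps)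
  have L0: "L \<ge> 0" using L by (rule lipschitz_on_nonneg)
  show "L-lipschitz_on UNIV (\<lambda>z. g (?p z))"
  proof (rule lipschitz_onI[OF _ L0])
    fix y z
    have "dist (g (?p y)) (g (?p z)) \<le> L * dist (?p y) (?p z)"
      using L by (rule lipschitz_onD) (use p sub in blast)+
    also have "\<dots> \<le> L * dist y z"
      using e L0 by (intro mult_left_mono closest_point_lipschitz) auto
    finally show "dist (g (?p y)) (g (?p z)) \<le> L * dist y z" .
  qed
  show "g (?p z) = g z" if "z \<in> ball x (e / 2)" for z
    using that by (subst closest_point_self) auto
qed

section \<open>Limits of gradients: compactness, existence and control of increments\<close>

lemma GDERIV_transform_ball:
  assumes "GDERIV f z :> D" "z \<in> ball x e" "\<And>y. y \<in> ball x e \<Longrightarrow> f y = g y"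
  shows "GDERIV g z :> D"
  using assms unfolding gderiv_def by (metis has_derivative_transform_within_open open_ball)

text \<open>\<open>clarke_gradient\<close> before the convex hull is taken. Compactness, and later
  the inclusion in \<open>Q_hat\<close>, are proved for this set and then pass to the hulls.\<close>

definition limiting_gradients :: "('a::real_inner \<Rightarrow> real) \<Rightarrow> 'a \<Rightarrow> 'a set" where
  "limiting_gradients f x = {v. \<exists>X. X \<longlonglongrightarrow> x \<and> (\<forall>k. f differentiable (at (X k))) \<and>
         (\<lambda>k. gradient f (X k)) \<longlonglongrightarrow> v}"

lemma clarke_gradient_hull: "clarke_gradient f x = convex hull (limiting_gradients f x)"
  by (simp add: clarke_gradient_def limiting_gradients_def)

text \<open>The form without sequences turns closedness into an argument with halved
  tolerances.\<close>

lemma limiting_gradients_iff: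
  "v \<in> limiting_gradients f x \<longleftrightarrow>
    (\<forall>e>0. \<exists>z. dist z x < e \<and> f differentiable (at z) \<and> dist (gradient f z) v < e)" (is "_ \<longleftrightarrow> ?R")
proof
  assume "v \<in> limiting_gradients f x"
  then obtain X where X: "X \<longlonglongrightarrow> x" "\<And>k. f differentiable (at (X k))" "(\<lambda>k. gradient f (X k)) \<longlonglongrightarrow> v"
    by (auto simp: limiting_gradients_def)
  show ?R
  proof (intro allI impI)
    fix e :: real assume "e > 0"
    then have "\<forall>\<^sub>F k in sequentially. dist (X k) x < e" "\<forall>\<^sub>F k in sequentially. dist (gradient f (X k)) v < e"
      using X(1,3) by (auto intro: tendstoD)
    then have "\<forall>\<^sub>F k in sequentially. dist (X k) x < e \<and> dist (gradient f (X k)) v < e" by (rule eventually_conj)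
    then show "\<exists>z. dist z x < e \<and> f differentiable (at z) \<and> dist (gradient f z) v < e"
      using X(2) by (auto simp: eventually_sequentially)
  qed
next
  assume R: ?R
  have "\<forall>k. \<exists>z. dist z x < 1 / Suc k \<and> f differentiable (at z) \<and> dist (gradient f z) v < 1 / Suc k"
    using R by simp
  then obtain X where X: "\<And>k. dist (X k) x < 1 / Suc k" "\<And>k. f differentiable (at (X k))"
      "\<And>k. dist (gradient f (X k)) v < 1 / Suc k"
    by metis
  have lim: "(\<lambda>k. 1 / real (Suc k)) \<longlonglongrightarrow> 0" using LIMSEQ_Suc[OF lim_1_over_n] by simp
  have "X \<longlonglongrightarrow> x"
    by (subst tendsto_dist_iff, rule tendsto_sandwich[OF _ _ tendsto_const lim])
       (use X(1) in \<open>auto intro!: always_eventually less_imp_le\<close>)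
  moreover have "(\<lambda>k. gradient f (X k)) \<longlonglongrightarrow> v"
    by (subst tendsto_dist_iff, rule tendsto_sandwich[OF _ _ tendsto_const lim])
       (use X(3) in \<open>auto intro!: always_eventually less_imp_le\<close>)
  ultimately show "v \<in> limiting_gradients f x" using X(2) by (auto simp: limiting_gradients_def)
qed

lemma norm_gradient_le:
  fixes f :: "'a::euclidean_space \<Rightarrow> real"
  assumes L: "L-lipschitz_on (ball x e) f" and z: "z \<in> ball x e" "f differentiable (at z)"
  shows "norm (gradient f z) \<le> L"
proof (rule norm_GDERIV_le[OF differentiable_imp_GDERIV[OF z(2)]])
  show "L-lipschitz_on (ball z (e - dist x z)) f"
    using L by (rule lipschitz_on_subset) (smt (verit) mem_ball dist_triangle subsetI)
  show "e - dist x z > 0" using z by simp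
qed

lemma limiting_gradients_subsequence:
  fixes f :: "'a::euclidean_space \<Rightarrow> real"
  assumes L: "L-lipschitz_on (ball x e) f" and "\<And>k. X k \<in> ball x e" "X \<longlonglongrightarrow> x" "\<And>k. f differentiable (at (X k))"
  obtains v r where "v \<in> limiting_gradients f x" "strict_mono r" "(\<lambda>k. gradient f (X (r k))) \<longlonglongrightarrow> v"
proof -
  have "\<forall>k. gradient f (X k) \<in> cball 0 L"
    using norm_gradient_le[OF L] assms by simp
  then obtain v r where vr: "strict_mono r" "((\<lambda>k. gradient f (X k)) \<circ> r) \<longlonglongrightarrow> v"
    using compact_cball[of "0::'a" L] unfolding compact_def by metis
  have "(X \<circ> r) \<longlonglongrightarrow> x" using assms(3) vr(1) by (rule LIMSEQ_subseq_LIMSEQ)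
  then have "v \<in> limiting_gradients f x"
    using assms(4) vr(2) by (auto simp: limiting_gradients_def o_def)
  then show thesis using that vr by (simp add: o_def)
qed

lemma compact_limiting_gradients:
  fixes f :: "'a::euclidean_space \<Rightarrow> real"
  assumes L: "L-lipschitz_on (ball x e) f" and e: "e > 0"
  shows "compact (limiting_gradients f x)" "limiting_gradients f x \<subseteq> cball 0 L"
proof -
  show sub: "limiting_gradients f x \<subseteq> cball 0 L"
  proof
    fix v assume v: "v \<in> limiting_gradients f x"
    have "norm v \<le> L + \<eta>" if \<eta>: "\<eta> > 0" for \<eta>
    proof -
      obtain z where z: "dist z x < min e \<eta>" "f differentiable (at z)" "dist (gradient f z) v < min e \<eta>"
        using v e \<eta> unfolding limiting_gradients_iff by (metis min_less_iff_conj)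
      have "norm (gradient f z) \<le> L" using z by (intro norm_gradient_le[OF L]) (auto simp: dist_commute)
      moreover have "norm v \<le> norm (gradient f z) + dist (gradient f z) v"
        using norm_triangle_sub[of v "gradient f z"] by (simp add: dist_norm norm_minus_commute)
      ultimately show ?thesis using z by simp
    qed
    then have "norm v \<le> L" by (rule field_le_epsilon)
    then show "v \<in> cball 0 L" by simp
  qed
  have "closed (limiting_gradients f x)"
    unfolding closure_subset_eq[symmetric]
  proof
    fix v assume v: "v \<in> closure (limiting_gradients f x)"
    show "v \<in> limiting_gradients f x"
      unfolding limiting_gradients_iff
    proof (intro allI impI)
      fix \<eta> :: real assume \<eta>: "\<eta> > 0"
      obtain u where u: "u \<in> limiting_gradients f x" "dist u v < \<eta> / 2"
        using v \<eta> by (metis closure_approachable half_gt_zero)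
      obtain z where z: "dist z x < \<eta> / 2" "f differentiable (at z)" "dist (gradient f z) u < \<eta> / 2"
        using u(1) \<eta> unfolding limiting_gradients_iff by (metis half_gt_zero)
      have "dist (gradient f z) v < \<eta>" using dist_triangle[of "gradient f z" v u] z u by simp
      then show "\<exists>z. dist z x < \<eta> \<and> f differentiable (at z) \<and> dist (gradient f z) v < \<eta>"
        using z \<eta> by (intro exI[of _ z]) auto
    qed
  qed
  then show "compact (limiting_gradients f x)"
    using sub by (meson bounded_cball bounded_subset compact_eq_bounded_closed)
qed

text \<open>Rademacher's theorem supplies points of differentiability in every ball around x, and
  their gradients are bounded, so some subsequence converges. The multiplier rule requires a
  nonempty Clarke gradient.\<close>

lemma limiting_gradients_nonempty:
  fixes f :: "'a::euclidean_space \<Rightarrow> real"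
  assumes L: "L-lipschitz_on (ball x e) f" and e: "e > 0"
  shows "limiting_gradients f x \<noteq> {}"
proof -
  obtain g' where g': "L-lipschitz_on UNIV g'" "\<And>z. z \<in> ball x (e / 2) \<Longrightarrow> g' z = f z"
    using lipschitz_extension_from_ball[OF L e] by metis
  have "\<exists>z. z \<in> ball x (min (e / 2) (1 / Suc k)) \<and> f differentiable (at z)" for k :: nat
  proof -
    have "0 < min (e / 2) (1 / Suc k)" using e by simp
    then have "ball x (min (e / 2) (1 / Suc k)) \<noteq> {}" by (metis centre_in_ball empty_iff)
    then obtain z D where z: "z \<in> ball x (min (e / 2) (1 / Suc k))" "GDERIV g' z :> D"
      using AE_lborel_in_open[OF rademacher[OF g'(1)] open_ball] by metis
    have "GDERIV f z :> D"
      by (rule GDERIV_transform_ball[OF z(2), of x "e / 2"]) (use z(1) g'(2) in auto)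
    then show ?thesis using z by (auto simp: gderiv_def differentiable_def)
  qed
  then obtain X where X: "\<And>k::nat. X k \<in> ball x (min (e / 2) (1 / Suc k))" "\<And>k. f differentiable (at (X k))"
    by metis
  have lim: "(\<lambda>k. 1 / real (Suc k)) \<longlonglongrightarrow> 0" using LIMSEQ_Suc[OF lim_1_over_n] by simp
  have "dist (X k) x \<le> 1 / Suc k" for k using X(1)[of k] by (simp add: dist_commute)
  then have "X \<longlonglongrightarrow> x"
    by (subst tendsto_dist_iff, intro tendsto_sandwich[OF _ _ tendsto_const lim]) (auto intro!: always_eventually)
  moreover have "X k \<in> ball x e" for k using X(1)[of k] e by simp
  ultimately show ?thesis using limiting_gradients_subsequence[OF L _ _ X(2)] by auto
qed

text \<open>If gradients at points tending to x violated the bound, a subsequence would converge to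
  a Clarke gradient \<xi> with w \<bullet> \<xi> \<ge> c, which the strict inequality in the
  hypothesis excludes. The bound on nearby gradients then integrates along segments.\<close>

lemma clarke_increment_le:
  fixes g :: "'a::euclidean_space \<Rightarrow> real"
  assumes L: "L-lipschitz_on (ball x e) g" and e: "e > 0"
    and c: "\<And>\<xi>. \<xi> \<in> clarke_gradient g x \<Longrightarrow> w \<bullet> \<xi> < c"
  obtains \<delta> where "\<delta> > 0"
    "\<And>z t. z \<in> ball x \<delta> \<Longrightarrow> z + t *\<^sub>R w \<in> ball x \<delta> \<Longrightarrow> t \<ge> 0 \<Longrightarrow> g (z + t *\<^sub>R w) - g z \<le> t * c"
proof -
  have lim: "(\<lambda>k. 1 / real (Suc k)) \<longlonglongrightarrow> 0" using LIMSEQ_Suc[OF lim_1_over_n] by simp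
  have "\<exists>d>0. \<forall>z. z \<in> ball x (min e d) \<longrightarrow> g differentiable (at z) \<longrightarrow> w \<bullet> gradient g z \<le> c"
  proof (rule ccontr)
    assume neg: "\<not> ?thesis"
    have "\<exists>z. z \<in> ball x (min e (1 / Suc k)) \<and> g differentiable (at z) \<and> w \<bullet> gradient g z > c" for k :: nat
    proof -
      have "0 < 1 / real (Suc k)" by simp
      with neg have "\<not> (\<forall>z. z \<in> ball x (min e (1 / real (Suc k))) \<longrightarrow> g differentiable (at z) \<longrightarrow> w \<bullet> gradient g z \<le> c)"
        by blast
      then show ?thesis by (simp only: not_all not_imp not_le)
    qed
    then obtain X where X: "\<And>k::nat. X k \<in> ball x (min e (1 / Suc k))" "\<And>k. g differentiable (at (X k))"
        "\<And>k. w \<bullet> gradient g (X k) > c"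
      by metis
    have "dist (X k) x \<le> 1 / Suc k" for k using X(1)[of k] by (simp add: dist_commute)
    then have Xx: "X \<longlonglongrightarrow> x"
      by (subst tendsto_dist_iff, intro tendsto_sandwich[OF _ _ tendsto_const lim]) (auto intro!: always_eventually)
    have Xe: "X k \<in> ball x e" for k using X(1)[of k] by simp
    obtain v r where v: "v \<in> limiting_gradients g x" "(\<lambda>k. gradient g (X (r k))) \<longlonglongrightarrow> v"
      by (rule limiting_gradients_subsequence[OF L Xe Xx X(2)])
    have "c \<le> w \<bullet> v"
      by (rule tendsto_lowerbound[OF tendsto_inner[OF tendsto_const v(2)]])
         (use X(3) in \<open>auto intro!: always_eventually less_imp_le\<close>)
    moreover have "w \<bullet> v < c" using v(1) by (intro c) (simp add: clarke_gradient_hull hull_inc)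
    ultimately show False by simp
  qed
  then obtain d where d: "d > 0"
      "\<And>z. z \<in> ball x (min e d) \<Longrightarrow> g differentiable (at z) \<Longrightarrow> w \<bullet> gradient g z \<le> c"
    by blast
  obtain g' where g': "L-lipschitz_on UNIV g'" "\<And>z. z \<in> ball x (e / 2) \<Longrightarrow> g' z = g z"
    using lipschitz_extension_from_ball[OF L e] by metis
  define \<delta> where "\<delta> = min (e / 2) d"
  show thesis
  proof (rule that)
    show "\<delta> > 0" using d e by (simp add: \<delta>_def)
    fix z t assume z: "z \<in> ball x \<delta>" "z + t *\<^sub>R w \<in> ball x \<delta>" "t \<ge> 0"
    have "g' (z + t *\<^sub>R w) - g' z \<le> t * c"
    proof (rule lipschitz_increment_le[OF g'(1) open_ball convex_ball _ z])
      fix u D assume u: "u \<in> ball x \<delta>" "GDERIV g' u :> D"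
      have "GDERIV g u :> D"
        by (rule GDERIV_transform_ball[OF u(2), of x "e / 2"]) (use u(1) g'(2) in \<open>auto simp: \<delta>_def\<close>)
      moreover from this have "g differentiable (at u)" by (auto simp: gderiv_def differentiable_def)
      moreover have "u \<in> ball x (min e d)" using u e by (auto simp: \<delta>_def)
      ultimately show "w \<bullet> D \<le> c" using d(2) gradient_eqI by metis
    qed
    then show "g (z + t *\<^sub>R w) - g z \<le> t * c" using z by (simp add: g'(2) \<delta>_def)
  qed
qed

subsection \<open>A multiplier rule\<close>

text \<open>The penalty \<open>M\<close> makes a box of multipliers compact; along the Slater direction \<open>slater\<close> the
  penalised separating direction is corrected to a strictly feasible one.\<close>

lemma multiplier_rule:
  fixes K :: "'a::euclidean_space set" and a :: "'i::finite \<Rightarrow> 'a" and b :: "'i \<Rightarrow> 'b::euclidean_space"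
  assumes K: "compact K" "convex K" "K \<noteq> {}"
    and slater: "\<And>i. i \<in> I \<Longrightarrow> slater \<bullet> a i < 0"
    and H: "\<And>w u c. (\<And>i. i \<in> I \<Longrightarrow> w \<bullet> a i + u \<bullet> b i < 0) \<Longrightarrow> (\<And>\<xi>. \<xi> \<in> K \<Longrightarrow> w \<bullet> \<xi> < c) \<Longrightarrow> u \<bullet> v \<le> c"
  obtains \<xi> \<mu> where "\<xi> \<in> K" "\<And>i. \<mu> i \<ge> 0" "\<And>i. i \<notin> I \<Longrightarrow> \<mu> i = 0"
    "\<xi> + (\<Sum>i\<in>UNIV. \<mu> i *\<^sub>R a i) = 0" "v = (\<Sum>i\<in>UNIV. \<mu> i *\<^sub>R b i)"
proof -
  obtain N where N: "N \<ge> 0" "\<And>\<xi>. \<xi> \<in> K \<Longrightarrow> norm \<xi> \<le> N"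
    using compact_imp_bounded[OF K(1)] K(3) unfolding bounded_iff by (metis ex_in_conv norm_ge_zero order_trans)
  \<comment> \<open>The Slater margin; inserting 1 keeps the minimum meaningful when no constraint
    is active.\<close>
  define \<kappa> where "\<kappa> = Min (insert 1 ((\<lambda>i. - (slater \<bullet> a i)) ` I))"
  have \<kappa>: "\<kappa> > 0" "\<And>i. i \<in> I \<Longrightarrow> slater \<bullet> a i \<le> - \<kappa>"
  proof -
    show "\<kappa> > 0" using slater by (simp add: \<kappa>_def)
    show "slater \<bullet> a i \<le> - \<kappa>" if "i \<in> I" for i
    proof -
      have "\<kappa> \<le> - (slater \<bullet> a i)" unfolding \<kappa>_def using that by (intro Min_le) auto
      then show ?thesis by simp
    qed
  qed
  \<comment> \<open>A violation s is repaired by adding s / \<kappa> times \<open>slater\<close>,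
    which raises w \<bullet> \<xi> by at most M * s; a multiplier of size M charges exactly this
    price.\<close>
  define M where "M = norm slater * N / \<kappa>"
  have M: "M \<ge> 0" using N \<kappa> by (simp add: M_def)
  define B :: "(real^'i) set" where "B = cbox 0 (\<chi> i. if i \<in> I then M else 0)"
  define T where "T p = (fst p + (\<Sum>i\<in>UNIV. (snd p $ i) *\<^sub>R a i), \<Sum>i\<in>UNIV. (snd p $ i) *\<^sub>R b i)"
    for p :: "'a \<times> (real^'i)"
  have T: "linear T"
    by (rule linearI) (auto simp: T_def sum.distrib scaleR_add_left scaleR_sum_right algebra_simps)
  \<comment> \<open>The goal becomes 0 \<in> S: some \<xi> in K and \<mu> in the box B satisfy T
    (\<xi>, \<mu>) = (0, v).\<close>
  define S where "S = (+) (0, - v) ` (T ` (K \<times> B))"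
  have "compact (T ` (K \<times> B))"
    using T K(1) by (intro compact_continuous_image linear_continuous_on linear_conv_bounded_linear[THEN iffD1] compact_Times)
      (auto simp: B_def)
  then have "closed S" unfolding S_def by (intro compact_imp_closed compact_translation)
  moreover have "convex S"
    unfolding S_def using T K(2) by (intro convex_translation convex_linear_image convex_Times) (auto simp: B_def)
  moreover have "0 \<in> S"
  proof (rule ccontr)
    assume "0 \<notin> S"
    with \<open>closed S\<close> \<open>convex S\<close> obtain z \<beta> where z: "\<beta> > 0" "\<And>s. s \<in> S \<Longrightarrow> z \<bullet> s > \<beta>"
      using separating_hyperplane_closed_0[of S] by auto
    define w u where "w = - fst z" and "u = - snd z"
    define q where "q i = w \<bullet> a i + u \<bullet> b i" for i
    have sep: "w \<bullet> \<xi> + (\<Sum>i\<in>UNIV. \<mu> $ i * q i) < u \<bullet> v - \<beta>" if "\<xi> \<in> K" "\<mu> \<in> B" for \<xi> \<mu>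
    proof -
      have "(0, - v) + T (\<xi>, \<mu>) \<in> S" using that by (auto simp: S_def)
      then have "\<beta> < z \<bullet> ((0, - v) + T (\<xi>, \<mu>))" by (rule z(2))
      also have "\<dots> = - (w \<bullet> \<xi>) + u \<bullet> v - (\<Sum>i\<in>UNIV. \<mu> $ i * q i)"
        by (cases z) (simp add: T_def w_def u_def q_def inner_add_right inner_sum_right sum.distrib sum_negf sum_subtractf algebra_simps)
      finally show ?thesis by simp
    qed
    define s where "s = Max (insert 0 (q ` I))"
    have s: "s \<ge> 0" "\<And>i. i \<in> I \<Longrightarrow> q i \<le> s" by (auto simp: s_def intro: Max_ge)
    \<comment> \<open>Tested with \<mu> = 0 if s = 0, and otherwise with the whole weight M on a
      most violated constraint.\<close>
    have pen: "w \<bullet> \<xi> + M * s < u \<bullet> v - \<beta>" if \<xi>: "\<xi> \<in> K" for \<xi>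
    proof -
      have "s \<in> insert 0 (q ` I)" unfolding s_def by (rule Max_in) auto
      then consider "s = 0" | j where "j \<in> I" "s = q j" by auto
      then show ?thesis
      proof cases
        case 1
        have "(0 :: real^'i) \<in> B" using M by (simp add: B_def mem_box_cart)
        from sep[OF \<xi> this] 1 show ?thesis by simp
      next
        case 2
        have "axis j M \<in> B" using M 2 by (auto simp: B_def mem_box_cart axis_def)
        from sep[OF \<xi> this] show ?thesis using 2 by (simp add: axis_def if_distrib[of "\<lambda>t. t * _"] cong: if_cong)
      qed
    qed
    \<comment> \<open>An extra multiple of \<open>slater\<close> that makes the repaired direction
      strictly feasible; it costs at most \<beta> / 2, so half of the separation gap
      survives.\<close>
    define \<eta> where "\<eta> = \<beta> / (2 * (norm slater * N + 1))"
    have \<eta>: "\<eta> > 0" "\<eta> * (norm slater * N) \<le> \<beta> / 2"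
    proof -
      have p: "norm slater * N \<ge> 0" using N by simp
      show "\<eta> > 0" using z p by (simp add: \<eta>_def add_nonneg_pos)
      show "\<eta> * (norm slater * N) \<le> \<beta> / 2" using z p by (simp add: \<eta>_def field_simps add_nonneg_pos)
    qed
    have "u \<bullet> v \<le> u \<bullet> v - \<beta> / 2"
    proof (rule H)
      fix i assume i: "i \<in> I"
      have "(w + (s / \<kappa> + \<eta>) *\<^sub>R slater) \<bullet> a i + u \<bullet> b i = q i + (s / \<kappa> + \<eta>) * (slater \<bullet> a i)"
        by (simp add: q_def inner_add_left)
      also have "\<dots> \<le> s + (s / \<kappa> + \<eta>) * (- \<kappa>)"
        using s i \<kappa> \<eta> by (intro add_mono mult_left_mono) auto
      also have "\<dots> < 0" using \<kappa> \<eta> by (simp add: algebra_simps)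
      finally show "(w + (s / \<kappa> + \<eta>) *\<^sub>R slater) \<bullet> a i + u \<bullet> b i < 0" .
    next
      fix \<xi> assume \<xi>: "\<xi> \<in> K"
      have "slater \<bullet> \<xi> \<le> norm slater * N"
        using norm_cauchy_schwarz[of slater \<xi>] mult_left_mono[OF N(2)[OF \<xi>], of "norm slater"] by simp
      then have "(s / \<kappa> + \<eta>) * (slater \<bullet> \<xi>) \<le> (s / \<kappa> + \<eta>) * (norm slater * N)"
        using s \<kappa> \<eta> by (intro mult_left_mono) auto
      also have "\<dots> = M * s + \<eta> * (norm slater * N)" by (simp add: M_def algebra_simps)
      finally show "(w + (s / \<kappa> + \<eta>) *\<^sub>R slater) \<bullet> \<xi> < u \<bullet> v - \<beta> / 2"
        using pen[OF \<xi>] \<eta> by (simp add: inner_add_left)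
    qed
    then show False using z by simp
  qed
  ultimately obtain \<xi> \<mu> where \<xi>: "\<xi> \<in> K" and \<mu>: "\<mu> \<in> B" and eq: "(0, - v) + T (\<xi>, \<mu>) = 0"
    unfolding S_def by auto
  show thesis
  proof (rule that[of \<xi> "\<lambda>i. \<mu> $ i"])
    show "\<mu> $ i \<ge> 0" for i using \<mu> by (simp add: B_def mem_box_cart)
    show "\<mu> $ i = 0" if "i \<notin> I" for i using \<mu> that by (auto simp: B_def mem_box_cart intro: antisym dest: spec[of _ i])
    show "\<xi> + (\<Sum>i\<in>UNIV. \<mu> $ i *\<^sub>R a i) = 0" "v = (\<Sum>i\<in>UNIV. \<mu> $ i *\<^sub>R b i)"
      using eq by (auto simp: T_def zero_prod_def)
  qed (rule \<xi>)
qed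

subsection \<open>Lipschitz continuity of the value function\<close>

lemma locally_lipschitz_on_UNIV_ball:
  assumes "locally_lipschitz_on UNIV g"
  obtains e L where "e > 0" "L-lipschitz_on (ball x e) g"
  using assms unfolding locally_lipschitz_on_def by (metis UNIV_I Int_UNIV_right)

lemma locally_lipschitz_on_imp_isCont:
  assumes "locally_lipschitz_on S f" "open S" "x \<in> S"
  shows "isCont f x"
proof -
  obtain e L where e: "e > 0" "L-lipschitz_on (ball x e \<inter> S) f"
    using assms(1,3) unfolding locally_lipschitz_on_def by blast
  have "continuous_on (ball x e \<inter> S) f" using e(2) by (rule lipschitz_on_continuous_on)
  moreover have "open (ball x e \<inter> S)" using assms(2) by auto
  ultimately show ?thesis using assms(3) e(1) by (metis Int_iff centre_in_ball continuous_on_eq_continuous_at)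
qed

lemma locally_lipschitz_on_imp_continuous_on:
  assumes "locally_lipschitz_on S f" "open S"
  shows "continuous_on S f"
  using locally_lipschitz_on_imp_isCont[OF assms] by (simp add: continuous_at_imp_continuous_on)

lemma locally_lipschitz_on_compact:
  assumes "locally_lipschitz_on UNIV g" "compact X"
  obtains L where "L-lipschitz_on X g"
proof -
  \<comment> \<open>The notion \<open>local_lipschitz\<close> carries a time parameter; a dummy time
    ranging over {0} is supplied.\<close>
  have "local_lipschitz {0::real} X (\<lambda>_. g)"
    unfolding local_lipschitz_def
  proof (intro ballI)
    fix x and t :: real assume "x \<in> X"
    obtain e L where e: "e > 0" "L-lipschitz_on (ball x e) g"
      using assms(1) unfolding locally_lipschitz_on_def by (metis UNIV_I Int_UNIV_right)
    have "L-lipschitz_on (cball x (e / 2) \<inter> X) g"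
      by (rule lipschitz_on_subset[OF e(2)]) (use e(1) in auto)
    then show "\<exists>u>0. \<exists>L. \<forall>t\<in>cball t u \<inter> {0}. L-lipschitz_on (cball x u \<inter> X) g"
      using e(1) by (intro exI[of _ "e / 2"]) auto
  qed
  then show thesis
  proof (rule local_lipschitz_compact_implies_lipschitz[OF _ assms(2)])
    fix L assume "\<And>t. t \<in> {0::real} \<Longrightarrow> L-lipschitz_on X g"
    then show thesis using that by simp
  qed simp_all
qed

text \<open>On the way to the evader the term with factor a shrinks at rate a * norm (x - xE), while
  by the triangle inequality - norm (x - xP) grows at most at rate norm (x - xE).\<close>

lemma d_fun_toward_E_le:
  assumes "0 \<le> s" "s \<le> 1" "a \<ge> 0"
  shows "d_fun a l (x + s *\<^sub>R (xE - x)) xP xE \<le> d_fun a l x xP xE - s * (a - 1) * norm (x - xE)"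
proof -
  have "x + s *\<^sub>R (xE - x) - xE = (1 - s) *\<^sub>R (x - xE)" by (simp add: algebra_simps)
  then have 1: "norm (x + s *\<^sub>R (xE - x) - xE) = (1 - s) * norm (x - xE)" using assms by simp
  have eq: "(x + s *\<^sub>R (xE - x) - xP) + s *\<^sub>R (x - xE) = x - xP" by (simp add: algebra_simps)
  have "norm (x - xP) \<le> norm (x + s *\<^sub>R (xE - x) - xP) + norm (s *\<^sub>R (x - xE))"
    using norm_triangle_ineq[of "x + s *\<^sub>R (xE - x) - xP" "s *\<^sub>R (x - xE)"] unfolding eq .
  also have "norm (s *\<^sub>R (x - xE)) = s * norm (x - xE)" using assms by simp
  finally have "norm (x - xP) \<le> norm (x + s *\<^sub>R (xE - x) - xP) + s * norm (x - xE)" .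
  then show ?thesis unfolding d_fun_def 1 by (simp add: algebra_simps)
qed

lemma d_fun_perturb:
  assumes "a \<ge> 0"
  shows "d_fun a l x' xP' xE' \<le> d_fun a l x xP xE + norm ((x' - xP') - (x - xP)) + a * norm ((x' - xE') - (x - xE))"
proof -
  have "norm (x - xP) \<le> norm (x' - xP') + norm ((x' - xP') - (x - xP))"
    using norm_triangle_sub[of "x - xP" "x' - xP'"] norm_minus_commute[of "x - xP" "x' - xP'"] by linarith
  moreover have "a * norm (x' - xE') \<le> a * (norm (x - xE) + norm ((x' - xE') - (x - xE)))"
    by (rule mult_left_mono[OF norm_triangle_sub assms])
  ultimately show ?thesis by (simp add: d_fun_def algebra_simps)
qed

section \<open>Compactness and Lipschitz dependence of the admissible sets\<close>

lemma norm_fst_nth_le: "norm (fst (y :: ('n::finite, 'm::finite) config) $ i) \<le> norm y"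
  by (metis Finite_Cartesian_Product.norm_nth_le dual_order.trans norm_fst_le prod.collapse)

lemma norm_snd_config_le: "norm (snd (y :: ('n::finite, 'm::finite) config)) \<le> norm y"
  by (metis norm_snd_le prod.collapse)

lemma Dom_star_iff: "x \<in> Dom_star \<alpha> l y \<longleftrightarrow> (\<forall>i. d_fun (\<alpha> i) (l i) x (fst y $ i) (snd y) \<le> 0)"
  by (auto simp: Dom_star_def Dom_def)

lemma snd_in_Dom_star: "y \<in> Omega l \<Longrightarrow> snd y \<in> Dom_star \<alpha> l y"
  by (auto simp: Dom_star_iff Omega_def d_fun_def norm_minus_commute less_imp_le)

lemma open_Omega: "open (Omega l :: ('n::finite, 'm::finite) config set)"
proof -
  have "Omega l = (\<Inter>i. {y :: ('n, 'm) config. norm (fst y $ i - snd y) > l i})" by (auto simp: Omega_def)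
  also have "open \<dots>"
    by (intro open_INT finite_UNIV ballI open_Collect_less continuous_intros) auto
  finally show ?thesis .
qed

lemma closed_Dom_star: "closed (Dom_star \<alpha> l y)"
proof -
  have "Dom_star \<alpha> l y = (\<Inter>i. {x. d_fun (\<alpha> i) (l i) x (fst y $ i) (snd y) \<le> 0})"
    by (auto simp: Dom_star_iff)
  then show ?thesis unfolding d_fun_def
    by (auto intro!: closed_INT closed_Collect_le continuous_intros)
qed

text \<open>The distance from x to the pursuer is at most norm (x - snd y) plus the distance between
  the players, so a factor \<alpha> i > 1 confines x to a neighbourhood of the evader. The crude
  bound 2 * norm y stands for the distance between the players.\<close>

lemma Dom_star_norm_le:
  assumes \<alpha>: "\<alpha> i > 1" and l: "l i \<ge> 0" and x: "x \<in> Dom_star \<alpha> l y"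
  shows "norm (x - snd y) \<le> 2 * norm y / (\<alpha> i - 1)"
proof -
  have "\<alpha> i * norm (x - snd y) + l i \<le> norm (x - fst y $ i)"
    using x by (auto simp: Dom_star_iff d_fun_def dest: spec[of _ i])
  also have "\<dots> \<le> norm (x - snd y) + (norm (snd y) + norm (fst y $ i))"
    using norm_triangle_ineq[of "x - snd y" "snd y - fst y $ i"] norm_triangle_ineq4[of "snd y" "fst y $ i"]
    by simp
  also have "\<dots> \<le> norm (x - snd y) + 2 * norm y"
    using norm_fst_nth_le[of y i] norm_snd_config_le[of y] by simp
  finally have "(\<alpha> i - 1) * norm (x - snd y) \<le> 2 * norm y" using l by (simp add: algebra_simps)
  then show ?thesis using \<alpha> by (simp add: field_simps)
qed

lemma compact_Dom_star:
  assumes "\<And>i. \<alpha> i > 1" "\<And>i. l i > 0"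
  shows "compact (Dom_star \<alpha> l y)"
proof -
  \<comment> \<open>\<open>undefined\<close> serves as an arbitrary index: a single constraint
    already gives boundedness.\<close>
  have "Dom_star \<alpha> l y \<subseteq> cball (snd y) (2 * norm y / (\<alpha> undefined - 1))"
    using Dom_star_norm_le[of \<alpha> undefined l _ y] assms
    by (auto simp: dist_norm norm_minus_commute less_imp_le)
  then show ?thesis using closed_Dom_star[of \<alpha> l y] bounded_subset[OF bounded_cball]
    unfolding compact_eq_bounded_closed by blast
qed

lemma Vg_attained:
  fixes g :: "real^'n::finite \<Rightarrow> real" and y :: "('n, 'm::finite) config"
  assumes \<alpha>: "\<And>i. \<alpha> i > 1" and l: "\<And>i. l i > 0" and g: "continuous_on UNIV g" and y: "y \<in> Omega l"
  shows "Pset \<alpha> l g y \<noteq> {}" "\<And>x. x \<in> Dom_star \<alpha> l y \<Longrightarrow> Vg \<alpha> l g y \<le> g x"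
proof -
  have "\<exists>x0\<in>Dom_star \<alpha> l y. \<forall>x\<in>Dom_star \<alpha> l y. g x0 \<le> g x"
    by (rule continuous_attains_inf[OF compact_Dom_star[OF \<alpha> l] _ continuous_on_subset[OF g subset_UNIV]])
      (use snd_in_Dom_star[OF y] in blast)
  then obtain x0 where x0: "x0 \<in> Dom_star \<alpha> l y" "\<And>x. x \<in> Dom_star \<alpha> l y \<Longrightarrow> g x0 \<le> g x"
    by blast
  have V: "Vg \<alpha> l g y = g x0"
    unfolding Vg_def by (rule Least_equality) (use x0 in auto)
  show "Pset \<alpha> l g y \<noteq> {}" using x0 V by (auto simp: Pset_def)
  show "Vg \<alpha> l g y \<le> g x" if "x \<in> Dom_star \<alpha> l y" for x using x0 V that by simp
qed

text \<open>A point admissible at y violates the constraints at y' by at most A * norm (y' - y).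
  Moving it a proportional fraction of the way to the evader repairs this if it is not close to the
  evader; close to the evader all constraints at y' hold anyway.\<close>

lemma Dom_star_lipschitz:
  fixes y0 :: "('n::finite, 'm::finite) config"
  assumes \<alpha>: "\<And>i. \<alpha> i > 1" and l: "\<And>i. l i > 0" and y0: "y0 \<in> Omega l"
  obtains r C B where "r > 0" "C \<ge> 0" "ball y0 r \<subseteq> Omega l"
    "\<forall>y\<in>ball y0 r. Dom_star \<alpha> l y \<subseteq> cball 0 B"
    "\<forall>y\<in>ball y0 r. \<forall>y'\<in>ball y0 r. \<forall>x\<in>Dom_star \<alpha> l y.
       \<exists>x'\<in>Dom_star \<alpha> l y'. norm (x' - x) \<le> C * norm (y' - y)"
proof -
  \<comment> \<open>A quarter of the slack: moving y0 by less than \<eta> changes the distance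
    between the players by at most 2 * \<eta>, which leaves a slack of 2 * \<eta>.\<close>
  define \<eta> where "\<eta> = Min (range (\<lambda>i. (norm (fst y0 $ i - snd y0) - l i) / 4))"
  have \<eta>: "\<eta> > 0" "\<And>i. norm (fst y0 $ i - snd y0) \<ge> l i + 4 * \<eta>"
  proof -
    show "\<eta> > 0" using y0 by (auto simp: \<eta>_def Omega_def)
    show "norm (fst y0 $ i - snd y0) \<ge> l i + 4 * \<eta>" for i
    proof -
      have "\<eta> \<le> (norm (fst y0 $ i - snd y0) - l i) / 4" unfolding \<eta>_def by (intro Min_le) auto
      then show ?thesis by simp
    qed
  qed
  define A where "A = Max (range \<alpha>) + 1"
  have A: "1 + \<alpha> i \<le> A" for i by (simp add: A_def)
  have A2: "A > 2" using A[of undefined] \<alpha>[of undefined] by simp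
  define \<kappa> where "\<kappa> = Min (range \<alpha>) - 1"
  have \<kappa>: "\<kappa> > 0" "\<And>i. \<kappa> \<le> \<alpha> i - 1" using \<alpha> by (auto simp: \<kappa>_def)
  define B where "B = (norm y0 + \<eta>) + 2 * (norm y0 + \<eta>) / \<kappa>"
  have B: "norm x \<le> B" if y: "y \<in> ball y0 \<eta>" and x: "x \<in> Dom_star \<alpha> l y" for x y
  proof -
    have ny: "norm y \<le> norm y0 + \<eta>"
      using y norm_triangle_sub[of y y0] by (simp add: dist_norm norm_minus_commute)
    have "norm (x - snd y) \<le> 2 * norm y / (\<alpha> undefined - 1)" using \<alpha> l x by (intro Dom_star_norm_le) (auto intro: less_imp_le)
    also have "\<dots> \<le> 2 * (norm y0 + \<eta>) / \<kappa>" using ny \<kappa> \<eta> by (intro frac_le) auto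
    finally show ?thesis
      using norm_triangle_sub[of x "snd y"] norm_snd_config_le[of y] ny by (simp add: B_def)
  qed
  have E: "d_fun (\<alpha> i) (l i) (snd y) (fst y $ i) (snd y) \<le> - 2 * \<eta>" if y: "y \<in> ball y0 \<eta>" for y i
  proof -
    have "norm (fst y0 $ i - snd y0) \<le> norm (fst y $ i - snd y) + norm (fst (y0 - y) $ i) + norm (snd (y0 - y))"
      using norm_triangle_ineq4[of "(fst y $ i - snd y) + fst (y0 - y) $ i" "snd (y0 - y)"]
        norm_triangle_ineq[of "fst y $ i - snd y" "fst (y0 - y) $ i"]
      by (simp add: algebra_simps)
    also have "\<dots> \<le> norm (fst y $ i - snd y) + 2 * \<eta>"
      using y norm_fst_nth_le[of "y0 - y" i] norm_snd_config_le[of "y0 - y"] by (simp add: dist_norm)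
    finally show ?thesis using \<eta>(2)[of i] by (simp add: d_fun_def norm_minus_commute)
  qed
  \<comment> \<open>Chosen so that for s = \<sigma> * \<delta> the guaranteed decrease s * \<kappa>
    * (\<eta> / A) equals the possible violation A * \<delta>.\<close>
  define \<sigma> where "\<sigma> = A * A / (\<kappa> * \<eta>)"
  have \<sigma>: "\<sigma> \<ge> 0" "\<sigma> * (\<kappa> * \<eta>) = A * A" using \<kappa> \<eta> A2 by (auto simp: \<sigma>_def)
  have Om: "ball y0 \<eta> \<subseteq> Omega l"
  proof
    fix y assume y: "y \<in> ball y0 \<eta>"
    have "l i < norm (fst y $ i - snd y)" for i
      using E[OF y, of i] \<eta>(1) by (simp add: d_fun_def norm_minus_commute)
    then show "y \<in> Omega l" by (simp add: Omega_def)
  qed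
  show thesis
  proof (rule that[of \<eta> "\<sigma> * (2 * B)" B])
    show "\<eta> > 0" by (rule \<eta>)
    have "B \<ge> 0" using \<eta> \<kappa> by (simp add: B_def)
    then show "\<sigma> * (2 * B) \<ge> 0" using \<sigma> by simp
    show "ball y0 \<eta> \<subseteq> Omega l" by (rule Om)
    show "\<forall>y\<in>ball y0 \<eta>. Dom_star \<alpha> l y \<subseteq> cball 0 B" using B by auto
  next
    show "\<forall>y\<in>ball y0 \<eta>. \<forall>y'\<in>ball y0 \<eta>. \<forall>x\<in>Dom_star \<alpha> l y.
       \<exists>x'\<in>Dom_star \<alpha> l y'. norm (x' - x) \<le> \<sigma> * (2 * B) * norm (y' - y)"
    proof (intro ballI)
      fix y y' x assume y: "y \<in> ball y0 \<eta>" and y': "y' \<in> ball y0 \<eta>" and x: "x \<in> Dom_star \<alpha> l y"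
      define \<delta> where "\<delta> = norm (y' - y)"
      have E': "snd y' \<in> Dom_star \<alpha> l y'" using y' Om by (auto intro: snd_in_Dom_star)
      have xE: "norm (snd y' - x) \<le> 2 * B"
        using B[OF y x] B[OF y' E'] norm_triangle_ineq4[of "snd y'" x] by simp
      \<comment> \<open>At the cap s = 1 the new point is the evader itself, which is
        admissible.\<close>
      define s where "s = min 1 (\<sigma> * \<delta>)"
      have s: "0 \<le> s" "s \<le> 1" "s \<le> \<sigma> * \<delta>" using \<sigma> by (auto simp: s_def \<delta>_def)
      define x' where "x' = x + s *\<^sub>R (snd y' - x)"
      have "norm (x' - x) \<le> (\<sigma> * \<delta>) * (2 * B)"
        using s xE by (simp add: x'_def mult_mono)
      moreover have "x' \<in> Dom_star \<alpha> l y'"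
      proof (cases "s = 1")
        case True
        then show ?thesis using E' by (simp add: x'_def)
      next
        case False
        then have s\<delta>: "s = \<sigma> * \<delta>" by (auto simp: s_def min_def split: if_splits)
        show ?thesis unfolding Dom_star_iff
        proof
          fix i
          let ?d = "\<lambda>x. d_fun (\<alpha> i) (l i) x (fst y' $ i) (snd y')"
          have a0: "\<alpha> i \<ge> 0" using \<alpha>[of i] by simp
          have seg: "?d x' \<le> ?d x - s * (\<alpha> i - 1) * norm (x - snd y')"
            unfolding x'_def using s a0 by (intro d_fun_toward_E_le) auto
          show "?d x' \<le> 0"
          proof (cases "norm (x - snd y') \<ge> \<eta> / A")
            case True
            have "?d x \<le> d_fun (\<alpha> i) (l i) x (fst y $ i) (snd y) + norm (fst (y' - y) $ i) + \<alpha> i * norm (snd (y' - y))"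
              using d_fun_perturb[OF a0, of "l i" x "fst y' $ i" "snd y'" x "fst y $ i" "snd y"]
              by (simp add: norm_minus_commute)
            also have "\<dots> \<le> 0 + \<delta> + \<alpha> i * \<delta>"
              using x norm_fst_nth_le[of "y' - y" i] norm_snd_config_le[of "y' - y"] a0
              unfolding \<delta>_def by (intro add_mono mult_left_mono) (auto simp: Dom_star_iff)
            also have "\<dots> = (1 + \<alpha> i) * \<delta>" by (simp add: algebra_simps)
            also have "\<dots> \<le> A * \<delta>" using A[of i] by (intro mult_right_mono) (auto simp: \<delta>_def)
            finally have 1: "?d x \<le> A * \<delta>" .
            have "A * \<delta> = \<delta> * (A * A) / A" using A2 by simp
            also have "\<dots> = s * \<kappa> * (\<eta> / A)" unfolding \<sigma>(2)[symmetric] s\<delta> by (simp add: mult_ac)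
            also have "\<dots> \<le> s * (\<alpha> i - 1) * norm (x - snd y')"
              using True s \<kappa>(2)[of i] \<kappa>(1) A2 \<eta> by (intro mult_mono mult_nonneg_nonneg) auto
            finally show ?thesis using 1 seg by simp
          next
            case False
            have "?d x \<le> ?d (snd y') + norm (x - snd y') + \<alpha> i * norm (x - snd y')"
              using d_fun_perturb[OF a0, of "l i" x "fst y' $ i" "snd y'" "snd y'" "fst y' $ i" "snd y'"] by simp
            also have "\<dots> \<le> - 2 * \<eta> + (1 + \<alpha> i) * norm (x - snd y')"
              using E[OF y', of i] by (simp add: algebra_simps)
            also have "\<dots> \<le> - 2 * \<eta> + A * (\<eta> / A)"
              using False A[of i] a0 A2 \<eta> by (intro add_left_mono mult_mono) auto
            also have "\<dots> \<le> 0" using A2 \<eta> by simp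
            finally have "?d x \<le> 0" .
            moreover have "s * (\<alpha> i - 1) * norm (x - snd y') \<ge> 0" using s \<alpha>[of i] by simp
            ultimately show ?thesis using seg by linarith
          qed
        qed
      qed
      ultimately show "\<exists>x'\<in>Dom_star \<alpha> l y'. norm (x' - x) \<le> \<sigma> * (2 * B) * norm (y' - y)"
        by (auto simp: \<delta>_def mult_ac intro!: bexI[of _ x'])
    qed
  qed
qed

text \<open>A minimiser at y has a point admissible at y' within C * norm (y' - y), and g is
  Lipschitz on a ball containing all admissible points involved. Exchanging y and y' gives the other
  inequality.\<close>

lemma locally_lipschitz_Vg:
  fixes g :: "real^'n::finite \<Rightarrow> real" and \<alpha> l :: "'m::finite \<Rightarrow> real"
  assumes \<alpha>: "\<And>i. \<alpha> i > 1" and l: "\<And>i. l i > 0" and g: "locally_lipschitz_on UNIV g"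
  shows "locally_lipschitz_on (Omega l) (Vg \<alpha> l g)"
  unfolding locally_lipschitz_on_def
proof
  have cg: "continuous_on UNIV g" using g by (intro locally_lipschitz_on_imp_continuous_on) auto
  fix y0 :: "('n, 'm) config" assume y0: "y0 \<in> Omega l"
  obtain r C B where r: "r > 0" "C \<ge> 0" "ball y0 r \<subseteq> Omega l"
    and B: "\<forall>y\<in>ball y0 r. Dom_star \<alpha> l y \<subseteq> cball 0 B"
    and near: "\<forall>y\<in>ball y0 r. \<forall>y'\<in>ball y0 r. \<forall>x\<in>Dom_star \<alpha> l y.
       \<exists>x'\<in>Dom_star \<alpha> l y'. norm (x' - x) \<le> C * norm (y' - y)"
    by (rule Dom_star_lipschitz[OF \<alpha> l y0])
  obtain L where L: "L-lipschitz_on (cball 0 B) g"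
    using locally_lipschitz_on_compact[OF g compact_cball] by blast
  have L0: "L \<ge> 0" using L by (rule lipschitz_on_nonneg)
  have le: "Vg \<alpha> l g y' \<le> Vg \<alpha> l g y + L * C * dist y y'" if y: "y \<in> ball y0 r" and y': "y' \<in> ball y0 r" for y y'
  proof -
    obtain x where x: "x \<in> Dom_star \<alpha> l y" "g x = Vg \<alpha> l g y"
      using Vg_attained(1)[where \<alpha>=\<alpha> and l=l, OF \<alpha> l cg subsetD[OF r(3) y]] by (auto simp: Pset_def)
    obtain x' where x': "x' \<in> Dom_star \<alpha> l y'" "norm (x' - x) \<le> C * norm (y' - y)"
      using near y y' x(1) by blast
    have "Vg \<alpha> l g y' \<le> g x'" by (rule Vg_attained(2)[OF \<alpha> l cg subsetD[OF r(3) y'] x'(1)])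
    also have "\<dots> \<le> g x + L * norm (x' - x)"
      using lipschitz_onD[OF L, of x' x] B[rule_format, OF y] B[rule_format, OF y'] x x' by (auto simp: dist_norm subset_iff)
    also have "\<dots> \<le> g x + L * (C * norm (y' - y))" using x' L0 by (intro add_left_mono mult_left_mono)
    finally show ?thesis by (simp add: x dist_norm norm_minus_commute)
  qed
  have "(L * C)-lipschitz_on (ball y0 r) (Vg \<alpha> l g)"
  proof (rule lipschitz_onI)
    show "dist (Vg \<alpha> l g y) (Vg \<alpha> l g y') \<le> L * C * dist y y'" if "y \<in> ball y0 r" "y' \<in> ball y0 r" for y y'
      using le[OF that] le[OF that(2,1)] by (simp add: dist_real_def dist_commute)
  qed (use L0 r in simp)
  then show "\<exists>e>0. \<exists>L. L-lipschitz_on (ball y0 e \<inter> Omega l) (Vg \<alpha> l g)"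
    using r(1) lipschitz_on_subset[OF _ inf_le1] by blast
qed

subsection \<open>Limits of gradients of the value function\<close>

text \<open>The unit vector is taken at the far end here and at the base point in
  \<open>norm_add_scaleR_ge\<close>. Both are exact consequences of Cauchy-Schwarz, with no
  remainder in t that would depend on the base point.\<close>

lemma norm_add_scaleR_le:
  fixes e \<epsilon> :: "'a::real_inner"
  assumes "e + t *\<^sub>R \<epsilon> \<noteq> 0"
  shows "norm (e + t *\<^sub>R \<epsilon>) \<le> norm e + t * ((e + t *\<^sub>R \<epsilon>) \<bullet> \<epsilon> / norm (e + t *\<^sub>R \<epsilon>))"
proof -
  define f where "f = e + t *\<^sub>R \<epsilon>"
  have nf: "norm f > 0" using assms by (simp add: f_def)
  have "norm f * norm f = f \<bullet> f" by (simp add: power2_norm_eq_inner flip: power2_eq_square)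
  also have "\<dots> = e \<bullet> f + t * (f \<bullet> \<epsilon>)" by (simp add: f_def inner_add_left inner_add_right inner_commute algebra_simps)
  also have "\<dots> \<le> norm e * norm f + t * (f \<bullet> \<epsilon>)" using norm_cauchy_schwarz[of e f] by simp
  finally have "norm f \<le> norm e + t * (f \<bullet> \<epsilon> / norm f)" using nf by (simp add: field_simps)
  then show ?thesis by (simp add: f_def)
qed

lemma norm_add_scaleR_ge:
  fixes p \<pi> :: "'a::real_inner"
  assumes "p \<noteq> 0"
  shows "norm p + t * (p \<bullet> \<pi> / norm p) \<le> norm (p + t *\<^sub>R \<pi>)"
proof -
  have "norm p * norm p + t * (p \<bullet> \<pi>) = p \<bullet> (p + t *\<^sub>R \<pi>)"
    by (simp add: inner_add_right power2_norm_eq_inner flip: power2_eq_square)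
  also have "\<dots> \<le> norm p * norm (p + t *\<^sub>R \<pi>)" by (rule norm_cauchy_schwarz)
  finally show ?thesis using assms by (simp add: field_simps)
qed

text \<open>An inactive constraint stays negative by continuity. For an active one the slope is
  continuous in (p', e', t) near (p, e, 0) and so stays negative there, and the two norm estimates
  bound the increase of the constraint by t times this slope.\<close>

lemma feasible_direction_stable:
  fixes p e \<pi> \<epsilon> :: "'a::real_inner"
  assumes a: "a \<ge> 0" and feas: "- norm p + a * norm e + l \<le> 0"
    and act: "- norm p + a * norm e + l = 0 \<Longrightarrow>
      e \<noteq> 0 \<and> p \<noteq> 0 \<and> a * (e \<bullet> \<epsilon> / norm e) - p \<bullet> \<pi> / norm p < 0"
  shows "\<exists>\<tau>>0. \<forall>p' e' t. norm (p' - p) < \<tau> \<longrightarrow> norm (e' - e) < \<tau> \<longrightarrow> 0 < t \<longrightarrow> t < \<tau> \<longrightarrow>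
      - norm p' + a * norm e' + l \<le> 0 \<longrightarrow> - norm (p' + t *\<^sub>R \<pi>) + a * norm (e' + t *\<^sub>R \<epsilon>) + l \<le> 0"
proof -
  \<comment> \<open>Reduces the claim to a condition P that holds near (p, e, 0) and keeps the step
    feasible; each of the two cases supplies its own P.\<close>
  have main: ?thesis if ev: "\<forall>\<^sub>F q in nhds (p, e, 0::real). P (fst q) (fst (snd q)) (snd (snd q))"
    and imp: "\<And>p' e' t. P p' e' t \<Longrightarrow> 0 < t \<Longrightarrow> - norm p' + a * norm e' + l \<le> 0 \<Longrightarrow>
       - norm (p' + t *\<^sub>R \<pi>) + a * norm (e' + t *\<^sub>R \<epsilon>) + l \<le> 0" for P
  proof -
    obtain d where d: "d > 0" "\<And>q. dist q (p, e, 0::real) < d \<Longrightarrow> P (fst q) (fst (snd q)) (snd (snd q))"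
      using ev unfolding eventually_nhds_metric by blast
    show ?thesis
    proof (intro exI[of _ "d / 3"] conjI allI impI)
      fix p' e' t assume *: "norm (p' - p) < d / 3" "norm (e' - e) < d / 3" "0 < t" "t < d / 3"
        "- norm p' + a * norm e' + l \<le> 0"
      have "dist (p', e', t) (p, e, 0) \<le> norm (p' - p) + (norm (e' - e) + \<bar>t\<bar>)"
      proof -
        have "dist (p', e', t) (p, e, 0) \<le> dist p' p + dist (e', t) (e, 0)"
          unfolding dist_Pair_Pair[of p'] by (intro sqrt_sum_squares_le_sum) auto
        also have "dist (e', t) (e, 0) \<le> dist e' e + dist t 0"
          unfolding dist_Pair_Pair by (intro sqrt_sum_squares_le_sum) auto
        finally show ?thesis by (simp add: dist_norm)
      qed
      then have "dist (p', e', t) (p, e, 0) < d" using * by simp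
      from d(2)[OF this] show "- norm (p' + t *\<^sub>R \<pi>) + a * norm (e' + t *\<^sub>R \<epsilon>) + l \<le> 0"
        using * by (intro imp) auto
    qed (use d in simp)
  qed
  have lt: "\<forall>\<^sub>F q in nhds z. f q < 0" if "f z < (0::real)" "isCont f z" for f and z :: "'a \<times> 'a \<times> real"
    using that by (intro order_tendstoD(2)[of f "f z"]) (auto simp: isCont_def tendsto_at_iff_tendsto_nhds)
  show ?thesis
  proof (cases "- norm p + a * norm e + l = 0")
    case False
    show ?thesis
    proof (rule main)
      show "\<forall>\<^sub>F q in nhds (p, e, 0::real). - norm (fst q + snd (snd q) *\<^sub>R \<pi>) + a * norm (fst (snd q) + snd (snd q) *\<^sub>R \<epsilon>) + l < 0"
        using False feas by (intro lt continuous_intros) auto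
    qed simp
  next
    case True
    note act = act[OF True]
    show ?thesis
    proof (rule main)
      have ne: "\<forall>\<^sub>F q in nhds z. f q \<noteq> 0" if "f z \<noteq> (0::'a)" "isCont f z" for f and z :: "'a \<times> 'a \<times> real"
        using that by (intro tendsto_imp_eventually_ne[of f "f z"]) (auto simp: isCont_def tendsto_at_iff_tendsto_nhds)
      show "\<forall>\<^sub>F q in nhds (p, e, 0::real). fst q \<noteq> 0 \<and> fst (snd q) + snd (snd q) *\<^sub>R \<epsilon> \<noteq> 0 \<and>
         a * ((fst (snd q) + snd (snd q) *\<^sub>R \<epsilon>) \<bullet> \<epsilon> / norm (fst (snd q) + snd (snd q) *\<^sub>R \<epsilon>)) - fst q \<bullet> \<pi> / norm (fst q) < 0"
        using act by (intro eventually_conj lt ne continuous_intros) auto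
    next
      fix p' e' t
      assume *: "p' \<noteq> 0 \<and> e' + t *\<^sub>R \<epsilon> \<noteq> 0 \<and> a * ((e' + t *\<^sub>R \<epsilon>) \<bullet> \<epsilon> / norm (e' + t *\<^sub>R \<epsilon>)) - p' \<bullet> \<pi> / norm p' < 0"
        and t: "0 < t" and f: "- norm p' + a * norm e' + l \<le> 0"
      have "a * norm (e' + t *\<^sub>R \<epsilon>) \<le> a * (norm e' + t * ((e' + t *\<^sub>R \<epsilon>) \<bullet> \<epsilon> / norm (e' + t *\<^sub>R \<epsilon>)))"
        using * a by (intro mult_left_mono norm_add_scaleR_le) auto
      moreover have "norm p' + t * (p' \<bullet> \<pi> / norm p') \<le> norm (p' + t *\<^sub>R \<pi>)"
        using * by (intro norm_add_scaleR_ge) auto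
      moreover have "t * (a * ((e' + t *\<^sub>R \<epsilon>) \<bullet> \<epsilon> / norm (e' + t *\<^sub>R \<epsilon>)) - p' \<bullet> \<pi> / norm p') \<le> 0"
        using * t by (intro mult_nonneg_nonpos) auto
      ultimately show "- norm (p' + t *\<^sub>R \<pi>) + a * norm (e' + t *\<^sub>R \<epsilon>) + l \<le> 0"
        using f by (simp add: algebra_simps)
    qed
  qed
qed

text \<open>When x moves with velocity w and y with velocity u, the vectors from the i-th pursuer
  and from the evader to x move with w - fst u $ i and w - snd u; the statement for one constraint
  then applies to each i.\<close>

lemma Dom_star_direction_stable:
  fixes y u :: "('n::finite, 'm::finite) config"
  assumes \<alpha>: "\<And>i. \<alpha> i > 1" and x: "x \<in> Dom_star \<alpha> l y"
    and act: "\<And>i. d_fun (\<alpha> i) (l i) x (fst y $ i) (snd y) = 0 \<Longrightarrow>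
      x \<noteq> snd y \<and> x \<noteq> fst y $ i \<and>
      \<alpha> i * ((x - snd y) \<bullet> (w - snd u) / norm (x - snd y)) - (x - fst y $ i) \<bullet> (w - fst u $ i) / norm (x - fst y $ i) < 0"
  obtains \<tau> where "\<tau> > 0"
    "\<forall>x' y' t. norm (x' - x) < \<tau> \<longrightarrow> norm (y' - y) < \<tau> \<longrightarrow> 0 < t \<longrightarrow> t < \<tau> \<longrightarrow>
      x' \<in> Dom_star \<alpha> l y' \<longrightarrow> x' + t *\<^sub>R w \<in> Dom_star \<alpha> l (y' + t *\<^sub>R u)"
proof -
  have "\<exists>\<tau>>0. \<forall>p' e' t. norm (p' - (x - fst y $ i)) < \<tau> \<longrightarrow> norm (e' - (x - snd y)) < \<tau> \<longrightarrow> 0 < t \<longrightarrow> t < \<tau> \<longrightarrow>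
      - norm p' + \<alpha> i * norm e' + l i \<le> 0 \<longrightarrow> - norm (p' + t *\<^sub>R (w - fst u $ i)) + \<alpha> i * norm (e' + t *\<^sub>R (w - snd u)) + l i \<le> 0" for i
  proof (rule feasible_direction_stable)
    show "\<alpha> i \<ge> 0" using \<alpha>[of i] by simp
  qed (use x act in \<open>auto simp: Dom_star_iff d_fun_def\<close>)
  then obtain T where T: "\<And>i. T i > 0" "\<And>i p' e' t. norm (p' - (x - fst y $ i)) < T i \<Longrightarrow> norm (e' - (x - snd y)) < T i \<Longrightarrow> 0 < t \<Longrightarrow> t < T i \<Longrightarrow>
      - norm p' + \<alpha> i * norm e' + l i \<le> 0 \<Longrightarrow> - norm (p' + t *\<^sub>R (w - fst u $ i)) + \<alpha> i * norm (e' + t *\<^sub>R (w - snd u)) + l i \<le> 0"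
    by metis
  \<comment> \<open>Halved because the displacement of each difference vector is bounded by the sum
    of those of x and y.\<close>
  define \<tau> where "\<tau> = Min (range T) / 2"
  have \<tau>: "\<tau> > 0" "\<And>i. 2 * \<tau> \<le> T i" using T(1) by (auto simp: \<tau>_def)
  show thesis
  proof (rule that[OF \<tau>(1)], intro allI impI)
    fix x' y' t assume *: "norm (x' - x) < \<tau>" "norm (y' - y) < \<tau>" "0 < t" "t < \<tau>" "x' \<in> Dom_star \<alpha> l y'"
    show "x' + t *\<^sub>R w \<in> Dom_star \<alpha> l (y' + t *\<^sub>R u)"
      unfolding Dom_star_iff
    proof
      fix i
      have "norm ((x' - fst y' $ i) - (x - fst y $ i)) \<le> norm (x' - x) + norm (fst (y' - y) $ i)"
        using norm_triangle_ineq4[of "x' - x" "fst (y' - y) $ i"] by (simp add: algebra_simps)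
      also have "\<dots> < T i" using * norm_fst_nth_le[of "y' - y" i] \<tau>(2)[of i] by linarith
      finally have 1: "norm ((x' - fst y' $ i) - (x - fst y $ i)) < T i" .
      have "norm ((x' - snd y') - (x - snd y)) \<le> norm (x' - x) + norm (snd (y' - y))"
        using norm_triangle_ineq4[of "x' - x" "snd (y' - y)"] by (simp add: algebra_simps)
      also have "\<dots> < T i" using * norm_snd_config_le[of "y' - y"] \<tau>(2)[of i] by linarith
      finally have 2: "norm ((x' - snd y') - (x - snd y)) < T i" .
      have "t < T i" using * \<tau>(1) \<tau>(2)[of i] by linarith
      moreover have "- norm (x' - fst y' $ i) + \<alpha> i * norm (x' - snd y') + l i \<le> 0"
        using *(5) by (auto simp: Dom_star_iff d_fun_def)
      ultimately have "- norm ((x' - fst y' $ i) + t *\<^sub>R (w - fst u $ i)) + \<alpha> i * norm ((x' - snd y') + t *\<^sub>R (w - snd u)) + l i \<le> 0"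
        using T(2)[OF 1 2 *(3)] by blast
      moreover have "(x' - fst y' $ i) + t *\<^sub>R (w - fst u $ i) = x' + t *\<^sub>R w - fst (y' + t *\<^sub>R u) $ i"
        "(x' - snd y') + t *\<^sub>R (w - snd u) = x' + t *\<^sub>R w - snd (y' + t *\<^sub>R u)"
        by (simp_all add: algebra_simps)
      ultimately show "d_fun (\<alpha> i) (l i) (x' + t *\<^sub>R w) (fst (y' + t *\<^sub>R u) $ i) (snd (y' + t *\<^sub>R u)) \<le> 0"
        by (simp add: d_fun_def)
    qed
  qed
qed

text \<open>The vector in the last factor is the gradient of \<open>d_fun\<close>, so multipliers
  for one function convert into multipliers for the other through the scalar in front.\<close>

lemma gradient_d_hat_active:
  assumes act: "d_fun a l x xP xE = 0" and P: "x \<noteq> xP" and E: "x \<noteq> xE"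
  shows "gradient (\<lambda>z. d_hat a l z xP xE) x =
    (8 * a * l * norm (x - xE) * norm (x - xP)) *\<^sub>R ((a / norm (x - xE)) *\<^sub>R (x - xE) - (1 / norm (x - xP)) *\<^sub>R (x - xP))"
    (is "_ = ?R")
    and "d_hat a l x xP xE = 0"
proof -
  define e p where "e = norm (x - xE)" and "p = norm (x - xP)"
  have p: "p = a * e + l" using act by (simp add: d_fun_def e_def p_def)
  have pos: "e > 0" "p > 0" using P E by (auto simp: e_def p_def)
  define A where "A = p\<^sup>2 - a\<^sup>2 * e\<^sup>2 - l\<^sup>2"
  \<comment> \<open>Activity enters here: with p = a * e + l the difference of squares collapses to
    a product, and both coefficients of the gradient acquire the factor 8 * a * l.\<close>
  have A: "A = 2 * a * l * e" unfolding A_def p by (simp add: power2_eq_square algebra_simps)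
  have fn: "d_hat a l z xP xE = - ((z - xP) \<bullet> (z - xP) - a\<^sup>2 * ((z - xE) \<bullet> (z - xE)) - l\<^sup>2)\<^sup>2 + 4 * a\<^sup>2 * l\<^sup>2 * ((z - xE) \<bullet> (z - xE))" for z
    by (simp add: d_hat_def power2_norm_eq_inner)
  have inn: "(x - xP) \<bullet> (x - xP) = p\<^sup>2" "(x - xE) \<bullet> (x - xE) = e\<^sup>2"
    by (simp_all add: e_def p_def power2_norm_eq_inner)
  have sq: "((\<lambda>z. (z - c) \<bullet> (z - c)) has_derivative (\<lambda>h. 2 * (h \<bullet> (x - c)))) (at x)" for c
    by (rule derivative_eq_intros refl)+ (simp add: inner_commute)
  have comp: "((\<lambda>z. - (U z - a\<^sup>2 * V z - l\<^sup>2)\<^sup>2 + 4 * a\<^sup>2 * l\<^sup>2 * V z) has_derivative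
      (\<lambda>h. - (2 * (U x - a\<^sup>2 * V x - l\<^sup>2) * (U' h - a\<^sup>2 * V' h)) + 4 * a\<^sup>2 * l\<^sup>2 * V' h)) (at x)"
    if "(U has_derivative U') (at x)" "(V has_derivative V') (at x)" for U V U' V'
    by (rule derivative_eq_intros refl that)+ (simp add: fun_eq_iff algebra_simps)
  have "((\<lambda>z. d_hat a l z xP xE) has_derivative
     (\<lambda>h. - (2 * A * (2 * (h \<bullet> (x - xP)) - a\<^sup>2 * (2 * (h \<bullet> (x - xE))))) + 4 * a\<^sup>2 * l\<^sup>2 * (2 * (h \<bullet> (x - xE))))) (at x)"
    using comp[OF sq[of xP] sq[of xE]] unfolding fn inn A_def .
  also have "(\<lambda>h. - (2 * A * (2 * (h \<bullet> (x - xP)) - a\<^sup>2 * (2 * (h \<bullet> (x - xE))))) + 4 * a\<^sup>2 * l\<^sup>2 * (2 * (h \<bullet> (x - xE))))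
     = (\<lambda>h. h \<bullet> ((- 4 * A) *\<^sub>R (x - xP) + (4 * A * a\<^sup>2 + 8 * a\<^sup>2 * l\<^sup>2) *\<^sub>R (x - xE)))"
    by (auto simp: fun_eq_iff inner_add_right algebra_simps)
  also have "(- 4 * A) *\<^sub>R (x - xP) + (4 * A * a\<^sup>2 + 8 * a\<^sup>2 * l\<^sup>2) *\<^sub>R (x - xE) = ?R"
  proof -
    have "?R = (8 * a * l * e * p * (a / e)) *\<^sub>R (x - xE) - (8 * a * l * e * p * (1 / p)) *\<^sub>R (x - xP)"
      by (simp add: scaleR_diff_right e_def p_def)
    also have "8 * a * l * e * p * (a / e) = 4 * A * a\<^sup>2 + 8 * a\<^sup>2 * l\<^sup>2"
      using pos by (simp add: A p power2_eq_square field_simps)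
    also have "8 * a * l * e * p * (1 / p) = 4 * A"
      using pos by (simp add: A)
    finally show ?thesis by simp
  qed
  finally show "gradient (\<lambda>z. d_hat a l z xP xE) x = ?R" by (intro gradient_eqI) (simp add: gderiv_def)
  have "d_hat a l x xP xE = - A\<^sup>2 + 4 * a\<^sup>2 * l\<^sup>2 * e\<^sup>2" by (simp add: d_hat_def A_def e_def p_def)
  then show "d_hat a l x xP xE = 0" by (simp add: A power_mult_distrib)
qed

text \<open>Admissible sets near y lie in one ball, so minimisers accumulate. The limit is
  admissible by continuity of \<open>d_fun\<close> and optimal by continuity of g and of
  \<open>Vg\<close>.\<close>

lemma minimizer_limit:
  fixes g :: "real^'n::finite \<Rightarrow> real" and \<alpha> l :: "'m::finite \<Rightarrow> real"
  assumes \<alpha>: "\<And>i. \<alpha> i > 1" and l: "\<And>i. l i > 0" and g: "locally_lipschitz_on UNIV g"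
    and y: "y \<in> Omega l" and Y: "Y \<longlonglongrightarrow> y" and YO: "\<And>k. Y k \<in> Omega l"
  obtains x r X where "x \<in> Pset \<alpha> l g y" "strict_mono r" "X \<longlonglongrightarrow> x" "\<forall>k. X k \<in> Pset \<alpha> l g (Y (r k))"
proof -
  have cont: "isCont g x" for x using locally_lipschitz_on_imp_isCont[OF g] by simp
  have cg: "continuous_on UNIV g" using g by (intro locally_lipschitz_on_imp_continuous_on) auto
  have V: "isCont (Vg \<alpha> l g) y"
    by (rule locally_lipschitz_on_imp_isCont[OF locally_lipschitz_Vg[OF \<alpha> l g] open_Omega y])
  obtain \<rho> C B where \<rho>: "\<rho> > 0" and B: "\<forall>y\<in>ball y \<rho>. Dom_star \<alpha> l y \<subseteq> cball 0 B"
    by (rule Dom_star_lipschitz[OF \<alpha> l y])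
  obtain N where N: "\<And>k. k \<ge> N \<Longrightarrow> dist (Y k) y < \<rho>"
    using Y \<rho> unfolding LIMSEQ_def by blast
  have "\<forall>k. \<exists>x. x \<in> Pset \<alpha> l g (Y (k + N))"
    using Vg_attained(1)[where \<alpha>=\<alpha> and l=l, OF \<alpha> l cg YO] by blast
  then obtain X where X: "\<And>k. X k \<in> Pset \<alpha> l g (Y (k + N))" by metis
  have "X k \<in> cball 0 B" for k
    using X[of k] N[of "k + N"] B[rule_format, of "Y (k + N)"] by (auto simp: Pset_def dist_commute)
  then obtain x s where s: "strict_mono (s :: nat \<Rightarrow> nat)" "(X \<circ> s) \<longlonglongrightarrow> x"
    using compact_cball[of "0 :: real^'n" B] unfolding compact_def by metis
  \<comment> \<open>The sequence X starts at index N, where the configurations have entered the ball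
    around y; r returns to the numbering of Y.\<close>
  define r where "r k = s k + N" for k
  have r: "strict_mono r" using s(1) by (simp add: strict_mono_def r_def)
  have Yr: "(\<lambda>k. Y (r k)) \<longlonglongrightarrow> y" using LIMSEQ_subseq_LIMSEQ[OF Y r] by (simp add: o_def)
  have Xs: "(\<lambda>k. X (s k)) \<longlonglongrightarrow> x" using s(2) by (simp add: o_def)
  have XP: "X (s k) \<in> Pset \<alpha> l g (Y (r k))" for k using X by (simp add: r_def)
  have "x \<in> Dom_star \<alpha> l y"
    unfolding Dom_star_iff
  proof
    fix i
    have "(\<lambda>k. d_fun (\<alpha> i) (l i) (X (s k)) (fst (Y (r k)) $ i) (snd (Y (r k)))) \<longlonglongrightarrow> d_fun (\<alpha> i) (l i) x (fst y $ i) (snd y)"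
      unfolding d_fun_def by (intro tendsto_intros Xs Yr)
    then show "d_fun (\<alpha> i) (l i) x (fst y $ i) (snd y) \<le> 0"
      by (rule tendsto_upperbound) (use XP in \<open>auto simp: Pset_def Dom_star_iff\<close>)
  qed
  moreover have "g x = Vg \<alpha> l g y"
  proof (rule LIMSEQ_unique)
    show "(\<lambda>k. g (X (s k))) \<longlonglongrightarrow> g x" using cont Xs by (rule isCont_tendsto_compose)
    have "g (X (s k)) = Vg \<alpha> l g (Y (r k))" for k using XP[of k] by (simp add: Pset_def)
    then show "(\<lambda>k. g (X (s k))) \<longlonglongrightarrow> Vg \<alpha> l g y" using isCont_tendsto_compose[OF V Yr] by simp
  qed
  ultimately show thesis using that[of x r "\<lambda>k. X (s k)"] r Xs XP by (auto simp: Pset_def)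
qed

lemma limit_gradient_direction_le:
  fixes g :: "real^'n::finite \<Rightarrow> real" and \<alpha> l :: "'m::finite \<Rightarrow> real" and Y :: "nat \<Rightarrow> ('n, 'm) config"
  assumes \<alpha>: "\<And>i. \<alpha> i > 1" and l: "\<And>i. l i > 0" and g: "locally_lipschitz_on UNIV g"
    and Y: "Y \<longlonglongrightarrow> y" "\<And>k. Y k \<in> Omega l" and X: "X \<longlonglongrightarrow> x" "\<And>k. X k \<in> Pset \<alpha> l g (Y k)"
    and diff: "\<And>k. Vg \<alpha> l g differentiable (at (Y k))" and v: "(\<lambda>k. gradient (Vg \<alpha> l g) (Y k)) \<longlonglongrightarrow> v"
    and x: "x \<in> Dom_star \<alpha> l y"
    and act: "\<And>i. d_fun (\<alpha> i) (l i) x (fst y $ i) (snd y) = 0 \<Longrightarrow>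
      x \<noteq> snd y \<and> x \<noteq> fst y $ i \<and>
      \<alpha> i * ((x - snd y) \<bullet> (w - snd u) / norm (x - snd y)) - (x - fst y $ i) \<bullet> (w - fst u $ i) / norm (x - fst y $ i) < 0"
    and c: "\<And>\<xi>. \<xi> \<in> clarke_gradient g x \<Longrightarrow> w \<bullet> \<xi> < c"
  shows "u \<bullet> v \<le> c"
proof -
  have cg: "continuous_on UNIV g" using g by (intro locally_lipschitz_on_imp_continuous_on) auto
  obtain e L where eL: "e > 0" "L-lipschitz_on (ball x e) g"
    using locally_lipschitz_on_UNIV_ball[OF g] by blast
  obtain \<delta> where \<delta>: "\<delta> > 0"
    "\<And>z t. z \<in> ball x \<delta> \<Longrightarrow> z + t *\<^sub>R w \<in> ball x \<delta> \<Longrightarrow> t \<ge> 0 \<Longrightarrow> g (z + t *\<^sub>R w) - g z \<le> t * c"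
    using clarke_increment_le[OF eL(2,1) c] by metis
  obtain \<tau> where \<tau>: "\<tau> > 0" "\<forall>x' y' t. norm (x' - x) < \<tau> \<longrightarrow> norm (y' - y) < \<tau> \<longrightarrow> 0 < t \<longrightarrow> t < \<tau> \<longrightarrow>
      x' \<in> Dom_star \<alpha> l y' \<longrightarrow> x' + t *\<^sub>R w \<in> Dom_star \<alpha> l (y' + t *\<^sub>R u)"
    by (rule Dom_star_direction_stable[OF \<alpha> x act])
  \<comment> \<open>Two limits are taken: for each large k, t tends to 0 and bounds the gradient at
    \<open>Y k\<close>; only then does k tend to infinity. The radii \<delta> and \<tau> belong to
    (x, y) and are independent of k.\<close>
  have "\<forall>\<^sub>F k in sequentially. dist (Y k) y < \<tau> \<and> dist (X k) x < \<tau> \<and> dist (X k) x < \<delta>"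
    using \<delta>(1) \<tau>(1) by (intro eventually_conj tendstoD[OF Y(1)] tendstoD[OF X(1)])
  then have "\<forall>\<^sub>F k in sequentially. u \<bullet> gradient (Vg \<alpha> l g) (Y k) \<le> c"
  proof eventually_elim
    case (elim k)
    have GD: "GDERIV (Vg \<alpha> l g) (Y k) :> gradient (Vg \<alpha> l g) (Y k)"
      using diff by (rule differentiable_imp_GDERIV)
    have lim: "((\<lambda>t. (Vg \<alpha> l g (Y k + t *\<^sub>R u) - Vg \<alpha> l g (Y k)) / t) \<longlongrightarrow> u \<bullet> gradient (Vg \<alpha> l g) (Y k)) (at_right 0)"
      using GDERIV_directional[OF GD] by (rule tendsto_mono[rotated]) (simp add: at_le)
    have Xk: "X k \<in> Dom_star \<alpha> l (Y k)" "g (X k) = Vg \<alpha> l g (Y k)" "X k \<in> ball x \<delta>"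
      using X(2)[of k] elim by (auto simp: Pset_def dist_commute)
    have t0: "((\<lambda>t. t) \<longlongrightarrow> (0::real)) (at_right 0)" by (rule tendsto_ident_at)
    have Yt: "((\<lambda>t. Y k + t *\<^sub>R u) \<longlongrightarrow> Y k) (at_right 0)"
      using tendsto_add[OF tendsto_const tendsto_scaleR[OF t0 tendsto_const], of "Y k" u] by simp
    have Xt: "((\<lambda>t. X k + t *\<^sub>R w) \<longlongrightarrow> X k) (at_right 0)"
      using tendsto_add[OF tendsto_const tendsto_scaleR[OF t0 tendsto_const], of "X k" w] by simp
    have "\<forall>\<^sub>F t in at_right 0. Y k + t *\<^sub>R u \<in> Omega l"
      using Yt open_Omega Y(2) by (rule topological_tendstoD)
    moreover have "\<forall>\<^sub>F t in at_right 0. X k + t *\<^sub>R w \<in> ball x \<delta>"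
      using Xt open_ball Xk(3) by (rule topological_tendstoD)
    moreover have "\<forall>\<^sub>F t in at_right (0::real). t < \<tau>" using t0 \<tau>(1) by (rule order_tendstoD)
    moreover have "\<forall>\<^sub>F t in at_right (0::real). 0 < t" by (simp add: eventually_at_right_less)
    ultimately have "\<forall>\<^sub>F t in at_right 0. (Vg \<alpha> l g (Y k + t *\<^sub>R u) - Vg \<alpha> l g (Y k)) / t \<le> c"
    proof eventually_elim
      case (elim t)
      have "X k + t *\<^sub>R w \<in> Dom_star \<alpha> l (Y k + t *\<^sub>R u)"
        using elim \<open>dist (Y k) y < \<tau> \<and> dist (X k) x < \<tau> \<and> dist (X k) x < \<delta>\<close> Xk(1)
        by (intro \<tau>(2)[rule_format]) (simp_all add: dist_norm)
      then have "Vg \<alpha> l g (Y k + t *\<^sub>R u) \<le> g (X k + t *\<^sub>R w)"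
        by (rule Vg_attained(2)[OF \<alpha> l cg elim(1)])
      also have "\<dots> \<le> Vg \<alpha> l g (Y k) + t * c"
        using \<delta>(2)[OF Xk(3) elim(2)] elim(4) Xk(2) by simp
      finally show ?case using elim(4) by (simp add: field_simps)
    qed
    then show ?case by (rule tendsto_upperbound[OF lim]) simp
  qed
  then show ?thesis by (rule tendsto_upperbound[OF tendsto_inner[OF tendsto_const v]]) simp
qed

theorem limiting_gradients_Vg_subset:
  fixes g :: "real^'n::finite \<Rightarrow> real" and \<alpha> l :: "'m::finite \<Rightarrow> real"
  assumes \<alpha>: "\<And>i. \<alpha> i > 1" and l: "\<And>i. l i > 0" and g: "locally_lipschitz_on UNIV g" and y: "y \<in> Omega l"
  shows "limiting_gradients (Vg \<alpha> l g) y \<subseteq> Q_hat \<alpha> l g y"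
proof
  fix v assume "v \<in> limiting_gradients (Vg \<alpha> l g) y"
  then obtain Y0 where Y0: "Y0 \<longlonglongrightarrow> y" "\<And>k. Vg \<alpha> l g differentiable (at (Y0 k))"
      "(\<lambda>k. gradient (Vg \<alpha> l g) (Y0 k)) \<longlonglongrightarrow> v"
    by (auto simp: limiting_gradients_def)
  obtain N where N: "\<And>k. k \<ge> N \<Longrightarrow> Y0 k \<in> Omega l"
    using topological_tendstoD[OF Y0(1) open_Omega y] unfolding eventually_sequentially by blast
  define Y where "Y k = Y0 (k + N)" for k
  have Y: "Y \<longlonglongrightarrow> y" "\<And>k. Y k \<in> Omega l" "\<And>k. Vg \<alpha> l g differentiable (at (Y k))"
      "(\<lambda>k. gradient (Vg \<alpha> l g) (Y k)) \<longlonglongrightarrow> v"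
    unfolding Y_def using LIMSEQ_ignore_initial_segment[OF Y0(1)] Y0(2) N
      LIMSEQ_ignore_initial_segment[OF Y0(3)] by auto
  obtain x r X where x: "x \<in> Pset \<alpha> l g y" and r: "strict_mono r" and X: "X \<longlonglongrightarrow> x" "\<forall>k. X k \<in> Pset \<alpha> l g (Y (r k))"
    by (rule minimizer_limit[OF \<alpha> l g y Y(1,2)])
  have Yr: "(\<lambda>k. Y (r k)) \<longlonglongrightarrow> y" "(\<lambda>k. gradient (Vg \<alpha> l g) (Y (r k))) \<longlonglongrightarrow> v"
    using LIMSEQ_subseq_LIMSEQ[OF Y(1) r] LIMSEQ_subseq_LIMSEQ[OF Y(4) r] by (simp_all add: o_def)
  have xD: "x \<in> Dom_star \<alpha> l y" using x by (simp add: Pset_def)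
  define I where "I = {i. d_fun (\<alpha> i) (l i) x (fst y $ i) (snd y) = 0}"
  define p where "p i = x - fst y $ i" for i
  define e where "e = x - snd y"
  have act: "x \<noteq> snd y \<and> x \<noteq> fst y $ i" if i: "i \<in> I" for i
  proof
    have d: "\<alpha> i * norm (x - snd y) + l i = norm (x - fst y $ i)" using i by (simp add: I_def d_fun_def)
    show "x \<noteq> snd y"
    proof
      assume "x = snd y"
      then have "l i = norm (fst y $ i - snd y)" using d by (simp add: norm_minus_commute)
      then show False using y by (auto simp: Omega_def dest: spec[of _ i])
    qed
    have "\<alpha> i * norm (x - snd y) \<ge> 0" using \<alpha>[of i] by simp
    then show "x \<noteq> fst y $ i" using d l[of i] by auto
  qed
  \<comment> \<open>For active i, \<open>a i\<close> and \<open>b i\<close> are the gradients of the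
    i-th \<open>d_fun\<close> at (x, y) with respect to x and to the configuration. Off I a division
    by 0 may occur, but there the multiplier is 0.\<close>
  define a where "a i = (\<alpha> i / norm e) *\<^sub>R e - (1 / norm (p i)) *\<^sub>R p i" for i
  define b where "b i = (axis i ((1 / norm (p i)) *\<^sub>R p i), - ((\<alpha> i / norm e) *\<^sub>R e))" for i
  have ab: "w \<bullet> a i + u \<bullet> b i = \<alpha> i * (e \<bullet> (w - snd u) / norm e) - p i \<bullet> (w - fst u $ i) / norm (p i)" for w u i
    by (cases u) (simp add: a_def b_def inner_axis inner_diff_left inner_diff_right inner_commute diff_divide_distrib algebra_simps)
  obtain \<epsilon> L where eL: "\<epsilon> > 0" "L-lipschitz_on (ball x \<epsilon>) g"
    using locally_lipschitz_on_UNIV_ball[OF g] by blast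
  note lg = compact_limiting_gradients[OF eL(2,1)] limiting_gradients_nonempty[OF eL(2,1)]
  obtain \<xi> \<mu> where \<xi>: "\<xi> \<in> clarke_gradient g x" and \<mu>: "\<And>i. \<mu> i \<ge> 0" "\<And>i. i \<notin> I \<Longrightarrow> \<mu> i = 0"
    and eq: "\<xi> + (\<Sum>i\<in>UNIV. \<mu> i *\<^sub>R a i) = 0" "v = (\<Sum>i\<in>UNIV. \<mu> i *\<^sub>R b i)"
  \<comment> \<open>The vector - e points from x to the evader. Cauchy-Schwarz bounds e \<bullet> p
    i / norm (p i) by norm e, and \<alpha> i > 1 makes the Slater inequality strict.\<close>
  proof (rule multiplier_rule[where K="clarke_gradient g x" and slater="- e" and I=I and a=a and b=b and v=v])
    show "compact (clarke_gradient g x)" "convex (clarke_gradient g x)" "clarke_gradient g x \<noteq> {}"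
      using lg by (auto simp: clarke_gradient_hull compact_convex_hull)
    fix i assume i: "i \<in> I"
    have pos: "norm e > 0" "norm (p i) > 0" using act[OF i] by (auto simp: e_def p_def)
    have "e \<bullet> p i / norm (p i) \<le> norm e" using norm_cauchy_schwarz[of e "p i"] pos by (simp add: field_simps)
    also have "\<dots> < \<alpha> i * norm e" using \<alpha>[of i] pos by simp
    also have "\<dots> = \<alpha> i * (e \<bullet> e / norm e)" using pos by (simp add: power2_eq_square flip: power2_norm_eq_inner)
    finally show "- e \<bullet> a i < 0" by (simp add: a_def inner_diff_right)
  next
    fix w u c assume H: "\<And>i. i \<in> I \<Longrightarrow> w \<bullet> a i + u \<bullet> b i < 0" "\<And>\<xi>. \<xi> \<in> clarke_gradient g x \<Longrightarrow> w \<bullet> \<xi> < c"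
    show "u \<bullet> v \<le> c"
    proof (rule limit_gradient_direction_le[OF \<alpha> l g Yr(1) _ X(1) _ _ Yr(2) xD _ H(2)])
      fix i assume "d_fun (\<alpha> i) (l i) x (fst y $ i) (snd y) = 0"
      then have i: "i \<in> I" by (simp add: I_def)
      show "x \<noteq> snd y \<and> x \<noteq> fst y $ i \<and>
        \<alpha> i * ((x - snd y) \<bullet> (w - snd u) / norm (x - snd y)) - (x - fst y $ i) \<bullet> (w - fst u $ i) / norm (x - fst y $ i) < 0"
        using act[OF i] H(1)[OF i] by (simp add: ab e_def p_def)
    qed (use X Y in auto)
  next
    fix \<xi> \<mu>
    assume "\<xi> \<in> clarke_gradient g x" "\<And>i. \<mu> i \<ge> 0" "\<And>i. i \<notin> I \<Longrightarrow> \<mu> i = 0"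
      "\<xi> + (\<Sum>i\<in>UNIV. \<mu> i *\<^sub>R a i) = 0" "v = (\<Sum>i\<in>UNIV. \<mu> i *\<^sub>R b i)"
    then show thesis by (rule that)
  qed
  \<comment> \<open>The ratio of the gradients of \<open>d_hat\<close> and \<open>d_fun\<close> at
    an active constraint; \<nu> divides by it on I and vanishes elsewhere, which yields
    complementary slackness.\<close>
  define m where "m i = 8 * \<alpha> i * l i * norm e * norm (p i)" for i
  define \<nu> where "\<nu> i = (if i \<in> I then \<mu> i / m i else 0)" for i
  have m: "m i > 0" if "i \<in> I" for i
    unfolding m_def using act[OF that] \<alpha>[of i] l[of i] by (simp add: e_def p_def)
  have grad: "\<nu> i *\<^sub>R gradient (\<lambda>z. d_hat (\<alpha> i) (l i) z (fst y $ i) (snd y)) x = \<mu> i *\<^sub>R a i" for i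
  proof (cases "i \<in> I")
    case True
    have "gradient (\<lambda>z. d_hat (\<alpha> i) (l i) z (fst y $ i) (snd y)) x = m i *\<^sub>R a i"
      using gradient_d_hat_active(1)[of "\<alpha> i" "l i" x "fst y $ i" "snd y"] act[OF True] True
      by (simp add: I_def m_def a_def e_def p_def)
    then show ?thesis using m[OF True] True by (simp add: \<nu>_def)
  qed (simp add: \<nu>_def \<mu>)
  have fst_b: "fst (\<mu> i *\<^sub>R b i) $ j = (if j = i then (8 * \<alpha> i * l i * \<nu> i * norm e) *\<^sub>R p i else 0)" for i j
    using m[of i] \<mu>(2)[of i] by (auto simp: b_def axis_def \<nu>_def m_def)
  have snd_b: "snd (\<mu> i *\<^sub>R b i) = - ((8 * (\<alpha> i)\<^sup>2 * l i * \<nu> i * norm (p i)) *\<^sub>R e)" for i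
  proof (cases "i \<in> I")
    case True
    have "p i \<noteq> 0" "l i \<noteq> 0" using act[OF True] l[of i] by (auto simp: p_def)
    then show ?thesis using m[OF True] True by (simp add: b_def \<nu>_def m_def power2_eq_square)
  qed (simp add: \<nu>_def \<mu> b_def)
  show "v \<in> Q_hat \<alpha> l g y"
    unfolding Q_hat_def
  proof (intro CollectI bexI[OF _ x] exI[of _ \<nu>] conjI allI)
    fix i
    show "\<nu> i \<ge> 0" using \<mu>(1)[of i] m[of i] by (auto simp: \<nu>_def intro: divide_nonneg_pos)
    show "\<nu> i * d_hat (\<alpha> i) (l i) x (fst y $ i) (snd y) = 0"
      using gradient_d_hat_active(2)[of "\<alpha> i" "l i" x "fst y $ i" "snd y"] act[of i]
      by (auto simp: \<nu>_def I_def)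
    show "fst v $ i = (8 * \<alpha> i * l i * \<nu> i * norm (x - snd y)) *\<^sub>R (x - fst y $ i)"
      unfolding eq(2) fst_sum sum_component fst_b by (simp add: e_def p_def)
  next
    show "0 \<in> (\<lambda>\<xi>. \<xi> + (\<Sum>i\<in>UNIV. \<nu> i *\<^sub>R
               gradient (\<lambda>z. d_hat (\<alpha> i) (l i) z (fst y $ i) (snd y)) x)) ` clarke_gradient g x"
      using \<xi> eq(1) by (auto simp: grad intro!: image_eqI[of _ _ \<xi>])
    show "snd v = - (\<Sum>i\<in>UNIV. (8 * (\<alpha> i)\<^sup>2 * l i * \<nu> i * norm (x - fst y $ i)) *\<^sub>R (x - snd y))"
      unfolding eq(2) snd_sum snd_b by (simp add: e_def p_def sum_negf)
  qed
qed

theorem proposition4p4: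
  fixes \<alpha> l :: "'m::finite \<Rightarrow> real"
    and g :: "real^'n::finite \<Rightarrow> real"
  assumes "CARD('n) \<ge> 2" and "CARD('m) \<ge> 1"
    and "\<And>i. \<alpha> i > 1" and "\<And>i. l i > 0"
    and "locally_lipschitz_on UNIV g"
  shows "locally_lipschitz_on (Omega l) (Vg \<alpha> l g) \<and>
         (\<forall>y \<in> Omega l. clarke_gradient (Vg \<alpha> l g) y \<subseteq> convex hull (Q_hat \<alpha> l g y))"
proof (intro conjI ballI)
  show "locally_lipschitz_on (Omega l) (Vg \<alpha> l g)"
    by (rule locally_lipschitz_Vg[OF assms(3-5)])
  fix y :: "('n, 'm) config" assume "y \<in> Omega l"
  then show "clarke_gradient (Vg \<alpha> l g) y \<subseteq> convex hull (Q_hat \<alpha> l g y)"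
    unfolding clarke_gradient_hull by (intro hull_mono limiting_gradients_Vg_subset assms)
qed

end
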